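(* Let $(u_n,\Psi _n)$ be a sequence of solutions satisfying \begin{equation*} \left\{ \begin{array}{rcl} -\Delta u_n(x) &=& 2V^2(x)|x|^{2\alpha_n}e^{2u_n(x)}-V(x)|x|^{\alpha_n}e^{u_n(x)}|\Psi_n|^2 \quad\\ \not{D}\Psi_n &=& -V(x)|x|^{\alpha_n}e^{u_n(x)}\Psi_n \end{array} \text {in } B_{r}, \right. \end{equation*} with the energy condition \begin{equation*} \int_{B_r}|x|^{2\alpha_n}e^{2u_n}dx<C,\text{ and }\int_{B_r}\left| \Psi _n\right| ^4dx<C. \end{equation*} for some constant $C>0$. Assume that \begin{itemize} \item[i)] $\alpha_n \in \mathbb{R} ^+, \alpha_n \rightarrow \alpha$ with $\alpha\geq 0$, \item[ii)] $V \in C^{1,\beta}(B_r), 0< a\leq V(x)\leq b < + \infty$. \end{itemize} Define \[\begin{array}{rcl} \Sigma _1&=&\left\{ x\in B_r,\text{ there is a sequence }y_n\rightarrow x\text{ such that }u_n(y_n)\rightarrow +\infty \right\}\\ \Sigma _2&=&\left\{ x\in B_r,\text{ there is a sequence }y_n\rightarrow x\text{ such that }\left| \Psi _n(y_n)\right| \rightarrow +\infty \right\} .\end{array} \] Then, we have $\Sigma_2\subset\Sigma_1$. Moreover, $(u_n,\Psi _n)$ admits a subsequence, still denoted by $( u_n,\Psi _n),$ satisfying \begin{enumerate} \item[a)] $\Psi _n$ is bounded in $ L_{loc}^{\infty} (B_r\backslash \Sigma _2)$ . \item[b)] For $u_n$, one of the following alternatives holds: \begin{enumerate} \item[i)] $u_n$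 is bounded in $L^{\infty}_{loc} (B_r).$ \item[ii)] $u_n$ $\rightarrow -\infty $ uniformly on compact subsets of $B_r$. \item[iii)] $\Sigma _1$ is finite, nonempty and either $u_n$ is bounded in $L_{loc}^\infty (B_r\backslash \Sigma _1)$ or $u_n\rightarrow -\infty$ uniformly on compact subsets of $B_r\backslash \Sigma _1$. \end{enumerate} \end{enumerate}
   Context: $B_r=B_r(0)$ is a disc in $\mathbb{R}^2$. $u_n$ are real-valued functions, $\Psi_n:B_r\to\mathbb{C}^2$ are spinor fields, and $\not{D}$ denotes the standard Dirac operator on $\mathbb{R}^2$: for $\Psi=(f,g)^T$, $\not{D}\Psi = 2\left(\frac{\partial g}{\partial \bar z}, -\frac{\partial f}{\partial z}\right)^T$ with $\frac{\partial}{\partial z}=\frac12(\partial_{x_1}-i\partial_{x_2})$, $\frac{\partial}{\partial \bar z}=\frac12(\partial_{x_1}+i\partial_{x_2})$. *)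

theory Defs
  imports "HOL-Analysis.Analysis"
begin

text \<open>We identify \<open>\<real>\<^sup>2\<close> with \<open>\<complex>\<close>: \<open>x = x1 + i x2\<close>.\<close>

definition px :: "(complex \<Rightarrow> 'a::real_normed_vector) \<Rightarrow> complex \<Rightarrow> 'a" where
  "px f x = vector_derivative (\<lambda>t. f (x + of_real t)) (at 0)"

definition py :: "(complex \<Rightarrow> 'a::real_normed_vector) \<Rightarrow> complex \<Rightarrow> 'a" where
  "py f x = vector_derivative (\<lambda>t. f (x + \<i> * of_real t)) (at 0)"

definition C1_on :: "complex set \<Rightarrow> (complex \<Rightarrow> 'a::real_normed_vector) \<Rightarrow> bool" where
  "C1_on S f \<longleftrightarrow> (\<exists>f'. (\<forall>x\<in>S. (f has_derivative blinfun_apply (f' x)) (at x))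
                        \<and> continuous_on S f')"

definition C2_on :: "complex set \<Rightarrow> (complex \<Rightarrow> 'a::real_normed_vector) \<Rightarrow> bool" where
  "C2_on S f \<longleftrightarrow> C1_on S f \<and> C1_on S (px f) \<and> C1_on S (py f)"

definition C1_holder_on :: "complex set \<Rightarrow> real \<Rightarrow> (complex \<Rightarrow> real) \<Rightarrow> bool" where
  "C1_holder_on S \<beta> f \<longleftrightarrow> (\<exists>f'. (\<forall>x\<in>S. (f has_derivative blinfun_apply (f' x)) (at x))
       \<and> (\<exists>K. \<forall>x\<in>S. \<forall>y\<in>S. norm (f' x - f' y) \<le> K * dist x y powr \<beta>))"

definition laplacian :: "(complex \<Rightarrow> real) \<Rightarrow> complex \<Rightarrow> real" where
  "laplacian u x = px (px u) x + py (py u) x"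

text \<open>Dirac operator: for \<open>\<Psi> = (f,g)\<close>, \<open>D\<Psi> = 2(\<partial>g/\<partial>z\<^sup>-, -\<partial>f/\<partial>z)\<close>.\<close>
definition dirac :: "(complex \<Rightarrow> complex \<times> complex) \<Rightarrow> complex \<Rightarrow> complex \<times> complex" where
  "dirac \<Psi> x = (px (\<lambda>y. snd (\<Psi> y)) x + \<i> * py (\<lambda>y. snd (\<Psi> y)) x,
                 - (px (\<lambda>y. fst (\<Psi> y)) x - \<i> * py (\<lambda>y. fst (\<Psi> y)) x))"

definition Sigma1 :: "(nat \<Rightarrow> complex \<Rightarrow> real) \<Rightarrow> real \<Rightarrow> complex set" where
  "Sigma1 u r = {x \<in> ball 0 r. \<exists>y. (\<forall>n. y n \<in> ball 0 r) \<and> y \<longlonglongrightarrow> x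
                   \<and> filterlim (\<lambda>n. u n (y n)) at_top sequentially}"

definition Sigma2 :: "(nat \<Rightarrow> complex \<Rightarrow> complex \<times> complex) \<Rightarrow> real \<Rightarrow> complex set" where
  "Sigma2 \<Psi> r = {x \<in> ball 0 r. \<exists>y. (\<forall>n. y n \<in> ball 0 r) \<and> y \<longlonglongrightarrow> x
                   \<and> filterlim (\<lambda>n. norm (\<Psi> n (y n))) at_top sequentially}"

text \<open>Bounded in \<open>L\<^sup>\<infinity>_loc(\<Omega>)\<close> (for continuous functions).\<close>
definition bounded_loc :: "complex set \<Rightarrow> (nat \<Rightarrow> complex \<Rightarrow> 'a::real_normed_vector) \<Rightarrow> bool" where
  "bounded_loc \<Omega> f \<longleftrightarrow> (\<forall>K. compact K \<and> K \<subseteq> \<Omega> \<longrightarrow> (\<exists>M. \<forall>n. \<forall>x\<in>K. norm (f n x) \<le> M))"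

definition to_minus_infty_loc :: "complex set \<Rightarrow> (nat \<Rightarrow> complex \<Rightarrow> real) \<Rightarrow> bool" where
  "to_minus_infty_loc \<Omega> u \<longleftrightarrow> (\<forall>K. compact K \<and> K \<subseteq> \<Omega> \<longrightarrow>
       (\<forall>M. eventually (\<lambda>n. \<forall>x\<in>K. u n x \<le> - M) sequentially))"

end

theory Submission
  imports Defs
begin

text \<open>
  Since \<open>-\<Delta>u \<le> 2 V\<^sup>2 |x|\<^bsup>2\<alpha>\<^esup> exp (2u)\<close>, the spinor term only helps for upper bounds on \<open>u\<close>. A point-picking
  argument shows that \<open>u\<close> is locally bounded above wherever the mass of \<open>|x|\<^bsup>2\<alpha>\<^esup> exp (2u)\<close> is small;
  so every blow-up point carries a fixed amount of mass and \<open>\<Sigma>\<^sub>1\<close> is finite. Where \<open>u\<close> is bounded above, the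
  Dirac equation has bounded coefficients, and the \<open>L\<^sup>4\<close> bound makes \<open>\<Psi>\<close> locally bounded; this gives
  \<open>\<Sigma>\<^sub>2 \<subseteq> \<Sigma>\<^sub>1\<close>. Off \<open>\<Sigma>\<^sub>1\<close> the Laplacian of \<open>u\<close> is thus bounded, and Harnack's inequality on the connected set
  \<open>B\<^sub>r - \<Sigma>\<^sub>1\<close> yields the dichotomy. The only analytic tool is the mean value property over circles, for
  the Laplacian and for the Cauchy-Riemann operator.
\<close>

subsection \<open>Means over circles and discs\<close>

text \<open>Membership in \<open>Sigma1\<close> or \<open>Sigma2\<close> demands blow-up along all
  indices n. A point outside them thus comes with bounds for infinitely many n only, and extraction
  may create new blow-up points. For the inclusion of \<open>Sigma2\<close> in \<open>Sigma1\<close>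
  infinitely many n suffice, since the spinor norm would diverge along the whole sequence; the local
  estimates therefore concern a single n, with constants chosen beforehand. For the alternatives
  extraction must stop, and it does because the number of blow-up points is at most
  \<open>C / \<epsilon>0\<close> for every subsequence. The threshold is explicit: at the picked
  point the mean value inequality loses at most 1 in the logarithm, hence a factor
  \<open>exp (-2)\<close> in the density, on a disc of area \<open>pi / (k * A)\<close>;
  concentration costs mass at least \<open>pi * exp (-2) / k\<close>. A further obstacle is the
  origin, where the weight vanishes: a bound on the density says nothing about u there, and u is
  recovered from circles that avoid 0.\<close>

definition complex_of_vec :: "real^2 \<Rightarrow> complex" where "complex_of_vec v = Complex (v $ 1) (v $ 2)"
definition vec_of_complex :: "complex \<Rightarrow> real^2" where "vec_of_complex z = vector [Re z, Im z]"

lemma vec_of_complex_nth [simp]: "vec_of_complex z $ 1 = Re z" "vec_of_complex z $ 2 = Im z"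
  by (auto simp: vec_of_complex_def)

lemma complex_of_vec_inverse [simp]: "complex_of_vec (vec_of_complex z) = z" "vec_of_complex (complex_of_vec v) = v"
  by (auto simp: complex_of_vec_def complex_eq_iff vec_eq_iff forall_2)

lemma linear_complex_of_vec: "linear complex_of_vec"
  by (rule linearI) (auto simp: complex_of_vec_def complex_eq_iff)

lemma linear_vec_of_complex: "linear vec_of_complex"
  by (rule linearI) (auto simp: vec_eq_iff forall_2)

lemma borel_complex_of_vec [measurable]: "complex_of_vec \<in> borel_measurable borel"
  by (intro borel_measurable_continuous_onI linear_continuous_on linear_conv_bounded_linear[THEN iffD1] linear_complex_of_vec)

text \<open>Boxes pull back to boxes with the same side lengths, and boxes determine Lebesgue
  measure.\<close>

lemma distr_complex_of_vec: "distr lborel borel complex_of_vec = lborel"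
proof (rule lborel_eqI[symmetric])
  fix l u :: complex assume le: "\<And>b. b \<in> Basis \<Longrightarrow> l \<bullet> b \<le> u \<bullet> b"
  have B: "complex_of_vec -` box l u = box (vec_of_complex l) (vec_of_complex u)"
    by (auto simp: box_def Basis_vec_def inner_axis forall_2 Basis_complex_def complex_of_vec_def)
  have B2: "(Basis :: (real^2) set) = {axis 1 1, axis 2 1}"
    by (auto simp: Basis_vec_def) (metis exhaust_2)
  have "emeasure (distr lborel borel complex_of_vec) (box l u) = emeasure lborel (box (vec_of_complex l) (vec_of_complex u))"
    by (subst emeasure_distr) (auto simp: B)
  also have "\<dots> = (\<Prod>b\<in>Basis. (vec_of_complex u - vec_of_complex l) \<bullet> b)"
    using le[of 1] le[of \<i>]
    by (subst emeasure_lborel_box) (auto simp: B2 inner_axis Basis_complex_def)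
  also have "(\<Prod>b\<in>Basis. (vec_of_complex u - vec_of_complex l) \<bullet> b) = (\<Prod>b\<in>Basis. (u - l) \<bullet> b)"
    by (simp add: B2 Basis_complex_def inner_axis axis_eq_axis)
  finally show "emeasure (distr lborel borel complex_of_vec) (box l u) = ennreal (\<Prod>b\<in>Basis. (u - l) \<bullet> b)" .
qed simp

lemma emeasure_complex_of_vec:
  assumes "S \<in> sets borel" shows "emeasure lborel (S::complex set) = emeasure lborel (complex_of_vec -` S)"
  by (subst distr_complex_of_vec[symmetric], subst emeasure_distr) (use assms in auto)

text \<open>The preimage of a box under multiplication by c is its image under multiplication by
  \<open>cnj c\<close>, which in \<open>real^2\<close> is the orthogonal map \<open>T\<close>. There
  \<open>measure_orthogonal_image\<close> applies, and finiteness of the measure of a box lifts the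
  result to \<open>emeasure\<close>.\<close>

lemma lborel_distr_rotate:
  fixes c :: complex assumes c: "cmod c = 1"
  shows "distr lborel borel (\<lambda>z. c * z) = (lborel :: complex measure)"
proof (rule lborel_eqI[symmetric])
  fix l u :: complex assume le: "\<And>b. b \<in> Basis \<Longrightarrow> l \<bullet> b \<le> u \<bullet> b"
  define T where "T = (\<lambda>v. vec_of_complex (cnj c * complex_of_vec v))"
  have cc: "cnj c * c = 1" using c by (metis complex_norm_square mult.commute of_real_1 power_one)
  have inv: "c * z \<in> S \<longleftrightarrow> z \<in> (\<lambda>w. cnj c * w) ` S" for z S
  proof -
    have "c * (cnj c * w) = w" "cnj c * (c * w) = w" for w
      using cc by (metis mult.assoc mult.commute mult_1)+
    then show ?thesis by (metis (no_types, lifting) image_iff)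
  qed
  have "linear T" unfolding T_def
    by (rule linearI) (auto simp: linear_add[OF linear_complex_of_vec] linear_cmul[OF linear_complex_of_vec]
        linear_add[OF linear_vec_of_complex] linear_cmul[OF linear_vec_of_complex] ring_distribs)
  moreover have "norm (T v) = norm v" for v
  proof -
    have n: "norm (vec_of_complex z) = cmod z" for z by (simp add: norm_vec_def L2_set_def sum_2 cmod_def)
    show ?thesis unfolding T_def n using c by (metis n complex_of_vec_inverse(2) norm_mult complex_mod_cnj mult_1)
  qed
  ultimately have T: "orthogonal_transformation T"
    by (simp add: orthogonal_transformation)
  have vi: "complex_of_vec -` ((\<lambda>z. c * z) -` box l u) = T ` (complex_of_vec -` box l u)"
  proof (intro set_eqI iffI)
    fix v assume "v \<in> complex_of_vec -` ((\<lambda>z. c * z) -` box l u)"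
    then obtain w where w: "w \<in> box l u" "complex_of_vec v = cnj c * w" using inv by auto
    have "v = T (vec_of_complex w)" unfolding T_def by (metis w(2) complex_of_vec_inverse)
    then show "v \<in> T ` (complex_of_vec -` box l u)" using w(1) by auto
  next
    fix v assume "v \<in> T ` (complex_of_vec -` box l u)"
    then obtain w where w: "complex_of_vec w \<in> box l u" "v = T w" by auto
    then show "v \<in> complex_of_vec -` ((\<lambda>z. c * z) -` box l u)"
      by (auto simp: T_def inv)
  qed
  have meas: "(\<lambda>z. c * z) -` box l u \<in> sets borel"
    using measurable_sets_borel[of "\<lambda>z. c * z" borel "box l u"] by auto
  have ob: "open (complex_of_vec -` box l u)"
    by (intro continuous_open_vimage linear_continuous_at linear_conv_bounded_linear[THEN iffD1] linear_complex_of_vec) auto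
  have bx: "complex_of_vec -` box l u = box (vec_of_complex l) (vec_of_complex u)"
    by (auto simp: box_def Basis_vec_def inner_axis forall_2 Basis_complex_def complex_of_vec_def)
  have lm: "complex_of_vec -` box l u \<in> lmeasurable" unfolding bx by simp
  have "emeasure (distr lborel borel (\<lambda>z. c * z)) (box l u) = emeasure lborel ((\<lambda>z. c * z) -` box l u)"
    by (subst emeasure_distr) auto
  also have "\<dots> = emeasure lborel (T ` (complex_of_vec -` box l u))"
    by (subst emeasure_complex_of_vec[OF meas]) (simp add: vi)
  also have "\<dots> = emeasure lebesgue (T ` (complex_of_vec -` box l u))"
    using measurable_sets_borel[OF borel_complex_of_vec meas] by (simp add: vi)
  also have "\<dots> = ennreal (measure lebesgue (T ` (complex_of_vec -` box l u)))"
    by (rule emeasure_eq_measure2) (use measurable_orthogonal_image[OF T lm] in auto)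
  also have "\<dots> = ennreal (measure lebesgue (complex_of_vec -` box l u))"
    by (simp add: measure_orthogonal_image[OF T lm])
  also have "\<dots> = emeasure lebesgue (complex_of_vec -` box l u)"
    by (rule emeasure_eq_measure2[symmetric]) (use lm in auto)
  also have "\<dots> = emeasure lborel (box l u)"
    by (subst emeasure_complex_of_vec) (auto simp: bx)
  also have "\<dots> = ennreal (\<Prod>b\<in>Basis. (u - l) \<bullet> b)"
    using le by (simp add: emeasure_lborel_box)
  finally show "emeasure (distr lborel borel (\<lambda>z. c * z)) (box l u) = ennreal (\<Prod>b\<in>Basis. (u - l) \<bullet> b)" .
qed simp

lemma nn_integral_rotate_translate:
  fixes H :: "complex \<Rightarrow> ennreal"
  assumes [measurable]: "H \<in> borel_measurable borel" and c: "cmod c = 1"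
  shows "(\<integral>\<^sup>+z. H (x0 + z * c) \<partial>lborel) = (\<integral>\<^sup>+z. H z \<partial>lborel)"
proof -
  have "(\<integral>\<^sup>+z. H (x0 + z * c) \<partial>lborel) = (\<integral>\<^sup>+z. H (x0 + z) \<partial>(distr lborel borel (\<lambda>z. c * z)))"
    by (subst nn_integral_distr) (auto simp: mult.commute)
  also have "\<dots> = (\<integral>\<^sup>+z. H z \<partial>(distr lborel borel ((+) x0)))"
    unfolding lborel_distr_rotate[OF c] by (subst nn_integral_distr) auto
  finally show ?thesis by (simp add: lborel_distr_plus)
qed

text \<open>By rotation invariance, averaging over \<open>\<theta>\<close> for every \<open>z\<close> of the disc and then integrating in \<open>z\<close>
  needs no polar coordinates.\<close>
lemma nn_integral_circle_means:
  fixes F :: "complex \<Rightarrow> real"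
  assumes cont: "continuous_on (ball x0 t) F" and nonneg: "\<And>x. x \<in> ball x0 t \<Longrightarrow> F x \<ge> 0"
  shows "(\<integral>\<^sup>+z\<in>ball 0 t. ennreal (integral {0..2*pi} (\<lambda>\<theta>. F (x0 + z * cis \<theta>))) \<partial>lborel)
       = ennreal (2*pi) * (\<integral>\<^sup>+x\<in>ball x0 t. ennreal (F x) \<partial>lborel)"
proof -
  \<comment> \<open>Extension of F by 0 makes the integrand measurable on the whole plane, so that
    Fubini and the change of variables apply without domains.\<close>
  define G where "G = (\<lambda>x. ennreal (indicator (ball x0 t) x *\<^sub>R F x))"
  have [measurable]: "G \<in> borel_measurable borel"
    unfolding G_def using cont borel_measurable_continuous_on_indicator by measurable
  have in_ball: "x0 + z * cis \<theta> \<in> ball x0 t \<longleftrightarrow> z \<in> ball 0 t" for z \<theta>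
    by (simp add: dist_norm norm_mult)
  have inner: "ennreal (integral {0..2*pi} (\<lambda>\<theta>. F (x0 + z * cis \<theta>))) * indicator (ball 0 t) z
     = (\<integral>\<^sup>+\<theta>. G (x0 + z * cis \<theta>) * indicator {0..2*pi} \<theta> \<partial>lborel)" for z
  proof (cases "z \<in> ball 0 t")
    case True
    define h where "h = (\<lambda>\<theta>. F (x0 + z * cis \<theta>))"
    have ch: "continuous_on UNIV h" unfolding h_def
      by (rule continuous_on_compose2[OF cont]) (use in_ball True in \<open>auto intro!: continuous_intros\<close>)
    have "(\<integral>\<^sup>+\<theta>. G (x0 + z * cis \<theta>) * indicator {0..2*pi} \<theta> \<partial>lborel)
       = (\<integral>\<^sup>+\<theta>. ennreal (indicator {0..2*pi} \<theta> * h \<theta>) \<partial>lborel)"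
      by (rule nn_integral_cong) (use in_ball True in \<open>auto simp: G_def h_def indicator_def\<close>)
    also have "\<dots> = ennreal (integral {0..2*pi} h)"
    proof (rule nn_integral_has_integral_lebesgue)
      show "(h has_integral integral {0..2*pi} h) {0..2*pi}"
        by (rule integrable_integral, rule integrable_continuous_real) (use ch continuous_on_subset in blast)
      show "0 \<le> h \<theta>" for \<theta> using nonneg in_ball True by (auto simp: h_def)
    qed
    finally show ?thesis using True by (simp add: h_def)
  next
    case False
    then show ?thesis using in_ball[of z] by (simp add: G_def)
  qed
  have "(\<integral>\<^sup>+z\<in>ball 0 t. ennreal (integral {0..2*pi} (\<lambda>\<theta>. F (x0 + z * cis \<theta>))) \<partial>lborel)
     = (\<integral>\<^sup>+z. \<integral>\<^sup>+\<theta>. G (x0 + z * cis \<theta>) * indicator {0..2*pi} \<theta> \<partial>lborel \<partial>lborel)"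
    by (simp add: inner)
  also have "\<dots> = (\<integral>\<^sup>+\<theta>. \<integral>\<^sup>+z. G (x0 + z * cis \<theta>) * indicator {0..2*pi} \<theta> \<partial>lborel \<partial>lborel)"
  proof (rule lborel_pair.Fubini'[where f="\<lambda>\<theta> z. G (x0 + z * cis \<theta>) * indicator {0..2*pi} \<theta>"])
    have "continuous_on UNIV (\<lambda>p::real\<times>complex. x0 + snd p * cis (fst p))"
      by (intro continuous_intros)
    then have [measurable]: "(\<lambda>p::real\<times>complex. x0 + snd p * cis (fst p)) \<in> borel_measurable (borel \<Otimes>\<^sub>M borel)"
      by (simp add: borel_prod borel_measurable_continuous_onI)
    have "(\<lambda>p::real\<times>complex. G (x0 + snd p * cis (fst p)) * indicator {0..2*pi} (fst p)) \<in> borel_measurable (borel \<Otimes>\<^sub>M borel)"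
      by measurable
    then show "(\<lambda>(\<theta>,z). G (x0 + z * cis \<theta>) * indicator {0..2*pi} \<theta>) \<in> borel_measurable (lborel \<Otimes>\<^sub>M lborel)"
      by (simp add: case_prod_beta' cong: measurable_cong_sets)
  qed
  \<comment> \<open>For fixed \<theta> the map from z to \<open>x0 + z * cis \<theta>\<close>
    preserves measure, so the inner integral no longer depends on \<theta>.\<close>
  also have "\<dots> = (\<integral>\<^sup>+\<theta>. (\<integral>\<^sup>+x. G x \<partial>lborel) * indicator {0..2*pi} \<theta> \<partial>lborel)"
    by (simp add: nn_integral_multc nn_integral_rotate_translate)
  also have "\<dots> = (\<integral>\<^sup>+x. G x \<partial>lborel) * ennreal (2*pi)"
    by (simp add: nn_integral_cmult)
  also have "(\<integral>\<^sup>+x. G x \<partial>lborel) = (\<integral>\<^sup>+x\<in>ball x0 t. ennreal (F x) \<partial>lborel)"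
    by (rule nn_integral_cong) (auto simp: G_def indicator_def)
  finally show ?thesis by (simp add: mult.commute)
qed

lemma emeasure_disc: "t \<ge> 0 \<Longrightarrow> emeasure lborel (ball (x::complex) t) = ennreal (pi * t\<^sup>2)"
  by (simp add: emeasure_ball unit_ball_vol_2)

text \<open>Integrating the bound c over z contributes the area of the disc; the factor
  \<open>2*pi\<close> stands on the right because circle integrals are not normalised. Extended
  nonnegative integrals avoid integrability conditions for F, which is continuous on the open ball
  only, and a negative c makes the left side 0.\<close>

lemma solid_mean_lower:
  fixes F :: "complex \<Rightarrow> real"
  assumes "continuous_on (ball x0 t) F" "\<And>x. x \<in> ball x0 t \<Longrightarrow> F x \<ge> 0" and t: "t \<ge> 0"
    and c: "\<And>z. z \<in> ball 0 t \<Longrightarrow> c \<le> integral {0..2*pi} (\<lambda>\<theta>. F (x0 + z * cis \<theta>))"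
  shows "ennreal (c * (pi * t\<^sup>2)) \<le> ennreal (2*pi) * (\<integral>\<^sup>+x\<in>ball x0 t. ennreal (F x) \<partial>lborel)"
proof -
  have "ennreal (c * (pi * t\<^sup>2)) = (\<integral>\<^sup>+z\<in>ball (0::complex) t. ennreal c \<partial>lborel)"
    using t by (simp add: nn_integral_cmult_indicator emeasure_disc ennreal_mult'')
  also have "\<dots> \<le> (\<integral>\<^sup>+z\<in>ball 0 t. ennreal (integral {0..2*pi} (\<lambda>\<theta>. F (x0 + z * cis \<theta>))) \<partial>lborel)"
    by (rule nn_integral_mono) (auto simp: indicator_def intro!: ennreal_leI c)
  finally show ?thesis using nn_integral_circle_means[OF assms(1,2)] by simp
qed

lemma solid_mean_upper:
  fixes F :: "complex \<Rightarrow> real"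
  assumes "continuous_on (ball x0 t) F" "\<And>x. x \<in> ball x0 t \<Longrightarrow> F x \<ge> 0" and t: "t \<ge> 0"
    and c: "\<And>z. z \<in> ball 0 t \<Longrightarrow> integral {0..2*pi} (\<lambda>\<theta>. F (x0 + z * cis \<theta>)) \<le> c"
  shows "ennreal (2*pi) * (\<integral>\<^sup>+x\<in>ball x0 t. ennreal (F x) \<partial>lborel) \<le> ennreal (c * (pi * t\<^sup>2))"
proof -
  have "(\<integral>\<^sup>+z\<in>ball 0 t. ennreal (integral {0..2*pi} (\<lambda>\<theta>. F (x0 + z * cis \<theta>))) \<partial>lborel)
      \<le> (\<integral>\<^sup>+z\<in>ball (0::complex) t. ennreal c \<partial>lborel)"
    by (rule nn_integral_mono) (auto simp: indicator_def intro!: ennreal_leI c)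
  also have "\<dots> = ennreal (c * (pi * t\<^sup>2))"
    using t by (simp add: nn_integral_cmult_indicator emeasure_disc ennreal_mult'')
  finally show ?thesis using nn_integral_circle_means[OF assms(1,2)] by simp
qed

section \<open>Partial derivatives and circle integrals\<close>

text \<open>The partial derivatives are arguments, so that sums, linear images and explicit
  functions carry theirs along instead of having to evaluate \<open>px\<close> and
  \<open>py\<close>.\<close>

definition has_partials :: "complex set \<Rightarrow> (complex \<Rightarrow> 'a::real_normed_vector) \<Rightarrow> (complex \<Rightarrow> 'a) \<Rightarrow> (complex \<Rightarrow> 'a) \<Rightarrow> bool" where
  "has_partials S f f1 f2 \<longleftrightarrow>
     (\<forall>x\<in>S. (f has_derivative (\<lambda>h. Re h *\<^sub>R f1 x + Im h *\<^sub>R f2 x)) (at x))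
     \<and> continuous_on S f1 \<and> continuous_on S f2"

lemma has_partials_D:
  assumes "has_partials S f f1 f2" "x \<in> S"
  shows "(f has_derivative (\<lambda>h. Re h *\<^sub>R f1 x + Im h *\<^sub>R f2 x)) (at x)"
  using assms by (auto simp: has_partials_def)

lemma has_partials_continuous_on:
  assumes "has_partials S f f1 f2" shows "continuous_on S f"
  using assms by (meson has_partials_D continuous_at_imp_continuous_on has_derivative_continuous)

lemma has_derivative_imp_px:
  assumes "(f has_derivative L) (at x)"
  shows "px f x = L 1" "py f x = L \<i>"
proof -
  have bl: "bounded_linear L" using assms by (rule has_derivative_bounded_linear)
  have eq: "L (c * of_real h) = h *\<^sub>R L c" for c h
    using linear_cmul[OF bounded_linear.linear[OF bl], of h c] by (simp add: scaleR_conv_of_real mult.commute)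
  have D: "((\<lambda>t. f (x + c * of_real t)) has_vector_derivative L c) (at 0)" for c
  proof -
    have "((\<lambda>t. f (x + c * of_real t)) has_derivative (\<lambda>h. L (c * of_real h))) (at 0)"
      by (rule has_derivative_compose[where g=f and g'=L]) (use assms in \<open>auto intro!: derivative_eq_intros\<close>)
    then show ?thesis by (simp add: has_vector_derivative_def eq)
  qed
  show "px f x = L 1" unfolding px_def using D[of 1] by (simp add: vector_derivative_at)
  show "py f x = L \<i>" unfolding py_def using D[of \<i>] by (simp add: vector_derivative_at)
qed

lemma C1_on_has_partials:
  assumes "C1_on S f" shows "has_partials S f (px f) (py f)"
proof -
  obtain f' where f': "\<And>x. x \<in> S \<Longrightarrow> (f has_derivative blinfun_apply (f' x)) (at x)" "continuous_on S f'"
    using assms by (auto simp: C1_on_def)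
  have px: "px f x = f' x 1" "py f x = f' x \<i>" if "x \<in> S" for x
    using has_derivative_imp_px[OF f'(1)[OF that]] by auto
  have "(f has_derivative (\<lambda>h. Re h *\<^sub>R px f x + Im h *\<^sub>R py f x)) (at x)" if "x \<in> S" for x
  proof -
    have "f' x h = Re h *\<^sub>R px f x + Im h *\<^sub>R py f x" for h
    proof -
      have "h = Re h *\<^sub>R 1 + Im h *\<^sub>R \<i>" by (simp add: complex_eq_iff)
      then have "f' x h = f' x (Re h *\<^sub>R 1 + Im h *\<^sub>R \<i>)" by simp
      then show ?thesis using that by (simp add: px blinfun.bilinear_simps)
    qed
    then have "blinfun_apply (f' x) = (\<lambda>h. Re h *\<^sub>R px f x + Im h *\<^sub>R py f x)" by blast
    then show ?thesis using f'(1)[OF that] by simp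
  qed
  moreover have "continuous_on S (px f)" "continuous_on S (py f)"
    using f'(2) by (auto simp: px intro!: continuous_intros cong: continuous_on_cong)
  ultimately show ?thesis by (auto simp: has_partials_def)
qed

text \<open>The unit direction w fixes the starting angle: a point z of a disc is written as
  \<open>\<rho> * w\<close>, and the circle through \<open>x0 + z\<close> is then parametrised from
  that point.\<close>

definition circ :: "complex \<Rightarrow> complex \<Rightarrow> (complex \<Rightarrow> 'a::banach) \<Rightarrow> real \<Rightarrow> 'a" where
  "circ x0 w f \<rho> = integral {0..2*pi} (\<lambda>\<theta>. f (x0 + of_real \<rho> * (w * cis \<theta>)))"

lemma circle_in_cball:
  assumes "cmod w = 1" "0 \<le> \<rho>" "\<rho> \<le> t"
  shows "x0 + of_real \<rho> * (w * cis \<theta>) \<in> cball x0 t"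
  using assms by (simp add: dist_norm norm_mult)

lemma continuous_on_circle:
  assumes "continuous_on S f" "cball x0 t \<subseteq> S" "cmod w = 1" "0 \<le> \<rho>" "\<rho> \<le> t"
  shows "continuous_on UNIV (\<lambda>\<theta>. f (x0 + of_real \<rho> * (w * cis \<theta>)))"
  by (rule continuous_on_compose2[OF assms(1)])
     (use assms(2) circle_in_cball[OF assms(3-5)] in \<open>auto intro!: continuous_intros\<close>)

lemma continuous_on_radius_angle:
  assumes "continuous_on S f" "cball x0 t \<subseteq> S" "cmod w = 1"
  shows "continuous_on ({0..t} \<times> A) (\<lambda>(\<rho>,\<theta>). f (x0 + of_real \<rho> * (w * cis \<theta>)))"
  unfolding case_prod_beta'
  by (rule continuous_on_compose2[OF assms(1)])
     (use assms(2) circle_in_cball[OF assms(3)] in \<open>auto intro!: continuous_intros\<close>)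

lemma has_vector_derivative_radius:
  assumes "has_partials S f f1 f2" "x0 + of_real \<rho> * c \<in> S"
  shows "((\<lambda>\<rho>. f (x0 + of_real \<rho> * c)) has_vector_derivative
      Re c *\<^sub>R f1 (x0 + of_real \<rho> * c) + Im c *\<^sub>R f2 (x0 + of_real \<rho> * c)) (at \<rho> within U)"
proof -
  have "((\<lambda>\<rho>. f (x0 + of_real \<rho> * c)) has_derivative
      (\<lambda>h. Re (of_real h * c) *\<^sub>R f1 (x0 + of_real \<rho> * c) + Im (of_real h * c) *\<^sub>R f2 (x0 + of_real \<rho> * c))) (at \<rho> within U)"
    by (rule has_derivative_compose[where f="\<lambda>\<rho>. x0 + of_real \<rho> * c" and g=f, OF _ has_partials_D[OF assms]]) (auto intro!: derivative_eq_intros)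
  then show ?thesis by (simp add: has_vector_derivative_def algebra_simps)
qed

lemma has_vector_derivative_angle:
  assumes "has_partials S f f1 f2" "x0 + of_real \<rho> * (w * cis \<theta>) \<in> S"
  shows "((\<lambda>\<theta>. f (x0 + of_real \<rho> * (w * cis \<theta>))) has_vector_derivative
      \<rho> *\<^sub>R (Re (w * cis \<theta>) *\<^sub>R f2 (x0 + of_real \<rho> * (w * cis \<theta>)) - Im (w * cis \<theta>) *\<^sub>R f1 (x0 + of_real \<rho> * (w * cis \<theta>)))) (at \<theta> within U)"
proof -
  have "((\<lambda>\<theta>. f (x0 + of_real \<rho> * (w * cis \<theta>))) has_derivative
      (\<lambda>h. Re (of_real \<rho> * (w * (of_real h * (\<i> * cis \<theta>)))) *\<^sub>R f1 (x0 + of_real \<rho> * (w * cis \<theta>))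
         + Im (of_real \<rho> * (w * (of_real h * (\<i> * cis \<theta>)))) *\<^sub>R f2 (x0 + of_real \<rho> * (w * cis \<theta>)))) (at \<theta> within U)"
    by (rule has_derivative_compose[where f="\<lambda>\<theta>. x0 + of_real \<rho> * (w * cis \<theta>)" and g=f, OF _ has_partials_D[OF assms]]) (auto intro!: derivative_eq_intros simp: scaleR_conv_of_real algebra_simps)
  then show ?thesis by (simp add: has_vector_derivative_def algebra_simps)
qed

text \<open>Differentiation under the integral sign, justified by joint continuity of the radial
  derivative in radius and angle.\<close>

lemma circ_deriv:
  fixes f :: "complex \<Rightarrow> 'a::euclidean_space"
  assumes f: "has_partials S f f1 f2" and S: "cball x0 t \<subseteq> S" and w: "cmod w = 1" and \<rho>: "\<rho> \<in> {0..t}"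
  shows "(circ x0 w f has_vector_derivative
      integral {0..2*pi} (\<lambda>\<theta>. Re (w * cis \<theta>) *\<^sub>R f1 (x0 + of_real \<rho> * (w * cis \<theta>))
                            + Im (w * cis \<theta>) *\<^sub>R f2 (x0 + of_real \<rho> * (w * cis \<theta>)))) (at \<rho> within {0..t})"
proof -
  note cont = has_partials_continuous_on[OF f]
  have c12: "continuous_on S f1" "continuous_on S f2" using f by (auto simp: has_partials_def)
  have "((\<lambda>\<rho>. integral (cbox 0 (2*pi)) (\<lambda>\<theta>. f (x0 + of_real \<rho> * (w * cis \<theta>)))) has_vector_derivative
      integral (cbox 0 (2*pi)) ((\<lambda>\<rho> \<theta>. Re (w * cis \<theta>) *\<^sub>R f1 (x0 + of_real \<rho> * (w * cis \<theta>))
                            + Im (w * cis \<theta>) *\<^sub>R f2 (x0 + of_real \<rho> * (w * cis \<theta>))) \<rho>)) (at \<rho> within {0..t})"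
  proof (rule leibniz_rule_vector_derivative)
    show "continuous_on ({0..t} \<times> cbox 0 (2*pi)) (\<lambda>(\<rho>, \<theta>). Re (w * cis \<theta>) *\<^sub>R f1 (x0 + of_real \<rho> * (w * cis \<theta>))
                            + Im (w * cis \<theta>) *\<^sub>R f2 (x0 + of_real \<rho> * (w * cis \<theta>)))"
      using continuous_on_radius_angle[OF c12(1) S w, unfolded case_prod_beta'] continuous_on_radius_angle[OF c12(2) S w, unfolded case_prod_beta']
      unfolding case_prod_beta' by (intro continuous_intros) auto
    fix \<rho> :: real assume r: "\<rho> \<in> {0..t}"
    show "(\<lambda>\<theta>. f (x0 + of_real \<rho> * (w * cis \<theta>))) integrable_on cbox 0 (2*pi)"
      using continuous_on_circle[OF cont S w] r by (intro integrable_continuous) (auto intro: continuous_on_subset)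
    fix \<theta> :: real
    show "((\<lambda>\<rho>. f (x0 + of_real \<rho> * (w * cis \<theta>))) has_vector_derivative Re (w * cis \<theta>) *\<^sub>R f1 (x0 + of_real \<rho> * (w * cis \<theta>))
                            + Im (w * cis \<theta>) *\<^sub>R f2 (x0 + of_real \<rho> * (w * cis \<theta>))) (at \<rho> within {0..t})"
      by (rule has_vector_derivative_radius[OF f]) (use S circle_in_cball[OF w] r in auto)
  qed (use \<rho> in auto)
  then show ?thesis by (simp add: circ_def[abs_def])
qed

lemma circ_0: "circ x0 w f 0 = (2*pi) *\<^sub>R f x0"
  by (simp add: circ_def)

text \<open>The radial derivative is \<open>exp (- i \<theta>) (\<partial>\<^sub>x + i \<partial>\<^sub>y) g\<close> minus \<open>i / \<rho>\<close> times the angular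
  derivative, which integrates to \<open>0\<close> over the circle.\<close>
lemma dbar_circle_mean:
  fixes g :: "complex \<Rightarrow> complex"
  assumes g: "has_partials S g g1 g2" and S: "cball x0 t \<subseteq> S" and w: "cmod w = 1"
    and K: "\<And>x. x \<in> cball x0 t \<Longrightarrow> cmod (g1 x + \<i> * g2 x) \<le> K" and \<rho>: "\<rho> \<in> {0..t}"
  shows "cmod (circ x0 w g \<rho> - (2*pi) *\<^sub>R g x0) \<le> 2 * pi * K * \<rho>"
proof -
  have c12: "continuous_on S g1" "continuous_on S g2" using g by (auto simp: has_partials_def)
  define J where "J = (\<lambda>\<rho>. integral {0..2*pi} (\<lambda>\<theta>. Re (w * cis \<theta>) *\<^sub>R g1 (x0 + of_real \<rho> * (w * cis \<theta>))
                            + Im (w * cis \<theta>) *\<^sub>R g2 (x0 + of_real \<rho> * (w * cis \<theta>))))"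
  have J: "(circ x0 w g has_vector_derivative J \<rho>) (at \<rho> within {0..t})" if "\<rho> \<in> {0..t}" for \<rho>
    unfolding J_def by (rule circ_deriv[OF g S w that])
  have nJ: "cmod (J \<rho>) \<le> 2*pi*K" if r: "0 < \<rho>" "\<rho> \<le> t" for \<rho>
  proof -
    define a where "a = (\<lambda>\<theta>. g1 (x0 + of_real \<rho> * (w * cis \<theta>)))"
    define b where "b = (\<lambda>\<theta>. g2 (x0 + of_real \<rho> * (w * cis \<theta>)))"
    have [continuous_intros]: "continuous_on {0..2*pi} a" "continuous_on {0..2*pi} b" unfolding a_def b_def
      using continuous_on_circle[OF c12(1) S w, of \<rho>] continuous_on_circle[OF c12(2) S w, of \<rho>] r
      by (auto intro: continuous_on_subset)
    have "((\<lambda>\<theta>. \<rho> *\<^sub>R (Re (w * cis \<theta>) *\<^sub>R b \<theta> - Im (w * cis \<theta>) *\<^sub>R a \<theta>)) has_integral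
           g (x0 + of_real \<rho> * (w * cis (2*pi))) - g (x0 + of_real \<rho> * (w * cis 0))) {0..2*pi}"
      unfolding a_def b_def
      by (rule fundamental_theorem_of_calculus)
        (use S circle_in_cball[OF w, of \<rho> t x0] r in \<open>auto simp del: times_complex.sel intro!: has_vector_derivative_angle[OF g]\<close>)
    then have "((\<lambda>\<theta>. (-\<i>/\<rho>) * (\<rho> *\<^sub>R (Re (w * cis \<theta>) *\<^sub>R b \<theta> - Im (w * cis \<theta>) *\<^sub>R a \<theta>))) has_integral (-\<i>/\<rho>) * 0) {0..2*pi}"
      by (intro has_integral_mult_right) simp
    then have i0: "((\<lambda>\<theta>. -\<i> * (Re (w * cis \<theta>) *\<^sub>R b \<theta> - Im (w * cis \<theta>) *\<^sub>R a \<theta>)) has_integral 0) {0..2*pi}"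
      using r by (simp add: scaleR_conv_of_real)
    have J_eq: "J \<rho> = integral {0..2*pi} (\<lambda>\<theta>. Re (w * cis \<theta>) *\<^sub>R a \<theta> + Im (w * cis \<theta>) *\<^sub>R b \<theta>)"
      by (simp add: J_def a_def b_def)
    have i1: "((\<lambda>\<theta>. Re (w * cis \<theta>) *\<^sub>R a \<theta> + Im (w * cis \<theta>) *\<^sub>R b \<theta>) has_integral J \<rho>) {0..2*pi}"
      unfolding J_eq by (intro integrable_integral integrable_continuous_real continuous_intros)
    have "((\<lambda>\<theta>. cnj (w * cis \<theta>) * (a \<theta> + \<i> * b \<theta>)) has_integral J \<rho>) {0..2*pi}"
      using has_integral_diff[OF i1 i0]
      by (rule has_integral_eq_rhs[OF has_integral_eq, rotated])
         (auto simp: complex_eq_iff algebra_simps)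
    moreover have "cmod (cnj (w * cis \<theta>) * (a \<theta> + \<i> * b \<theta>)) \<le> K" for \<theta>
      using K[OF circle_in_cball[OF w, of \<rho> t]] r w by (simp add: norm_mult a_def b_def)
    moreover have "K \<ge> 0" using K[of x0] r by (auto intro: order_trans[OF norm_ge_zero])
    ultimately have "cmod (J \<rho>) \<le> K * measure lborel {0..2*pi}"
      by (intro has_integral_bound_real) auto
    then show ?thesis by (simp add: mult.commute)
  qed
  have "dist (circ x0 w g \<rho>) (circ x0 w g 0) \<le> 2*pi*K * \<rho>"
  proof (cases "\<rho> = 0")
    case False
    \<comment> \<open>The bound \<open>nJ\<close> holds for positive radii only, because the angular
      term was divided by \<rho>; continuity of \<open>circ\<close> takes care of the endpoint
      0.\<close>
    have "norm (circ x0 w g \<rho> - circ x0 w g 0) \<le> (2*pi*K*\<rho>) - (2*pi*K*0)"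
    proof (rule differentiable_bound_general[of 0 \<rho> "circ x0 w g" "\<lambda>s. 2*pi*K * s" J "\<lambda>_. 2*pi*K"])
      show "0 < \<rho>" using False \<rho> by auto
      show "continuous_on {0..\<rho>} (circ x0 w g)"
        using J \<rho> by (intro continuous_on_subset[where s="{0..t}" and t="{0..\<rho>}"] continuous_on_vector_derivative) auto
      show "(circ x0 w g has_vector_derivative J s) (at s)" if "0 < s" "s < \<rho>" for s
      proof -
        have "at s within {0..t} = at s"
          by (rule at_within_interior) (use that \<rho> in \<open>simp add: interior_atLeastAtMost_real\<close>)
        then show ?thesis using J[of s] that \<rho> by simp
      qed
      show "((\<lambda>s. 2*pi*K * s) has_vector_derivative 2*pi*K) (at s)" for s
        by (auto intro!: derivative_eq_intros simp: has_real_derivative_iff_has_vector_derivative[symmetric])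
      show "norm (J s) \<le> 2*pi*K" if "0 < s" "s < \<rho>" for s using nJ[of s] that \<rho> by auto
    qed (auto intro!: continuous_intros)
    then show ?thesis by (simp add: dist_norm)
  qed simp
  then show ?thesis by (simp add: dist_norm circ_0)
qed

text \<open>For the circle integral \<open>m\<close> this is \<open>(\<rho> m')' = \<rho> \<integral> \<Delta>f d\<theta>\<close>, integrated twice.\<close>
lemma laplacian_circle_mean:
  fixes f p q :: "complex \<Rightarrow> real"
  assumes f: "has_partials S f p q" and p: "has_partials S p p1 p2" and q: "has_partials S q q1 q2"
    and S: "cball x0 t \<subseteq> S" and w: "cmod w = 1"
    and K: "\<And>x. x \<in> cball x0 t \<Longrightarrow> p1 x + q2 x \<ge> - K" and \<rho>: "\<rho> \<in> {0..t}"
  shows "2 * pi * (f x0 - K * \<rho>\<^sup>2 / 4) \<le> circ x0 w f \<rho>"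
proof -
  have c12: "continuous_on S p1" "continuous_on S p2" "continuous_on S q1" "continuous_on S q2"
    using p q by (auto simp: has_partials_def)
  note cpq = has_partials_continuous_on[OF p] has_partials_continuous_on[OF q]
  define c where "c = (\<lambda>\<theta>. w * cis \<theta>)"
  define z where "z = (\<lambda>\<rho> \<theta>. x0 + of_real \<rho> * c \<theta>)"
  have cc: "Re (c \<theta>) * Re (c \<theta>) + Im (c \<theta>) * Im (c \<theta>) = 1" for \<theta>
    using w by (metis c_def complex_norm_square cmod_power2 mult.right_neutral norm_cis norm_mult one_power2 power2_eq_square)
  have zt: "z \<rho> \<theta> \<in> cball x0 t" if "\<rho> \<in> {0..t}" for \<rho> \<theta>
    using circle_in_cball[OF w, of \<rho> t] that by (simp add: z_def c_def)
  have cz [continuous_intros]: "continuous_on {0..2*pi} (\<lambda>\<theta>. h (z \<rho> \<theta>))" if "continuous_on S h" "\<rho> \<in> {0..t}" for h :: "complex \<Rightarrow> real" and \<rho>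
    using continuous_on_circle[OF that(1) S w, of \<rho>] that by (auto simp: z_def c_def intro: continuous_on_subset)
  have cC [continuous_intros]: "continuous_on A (\<lambda>\<theta>. Re (c \<theta>))" "continuous_on A (\<lambda>\<theta>. Im (c \<theta>))" for A
    unfolding c_def by (intro continuous_intros)+
  define N where "N = (\<lambda>\<rho>. integral {0..2*pi} (\<lambda>\<theta>. Re (c \<theta>) * p (z \<rho> \<theta>) + Im (c \<theta>) * q (z \<rho> \<theta>)))"
  define N' where "N' = (\<lambda>\<rho>. integral {0..2*pi} (\<lambda>\<theta>.
      Re (c \<theta>) * (Re (c \<theta>) * p1 (z \<rho> \<theta>) + Im (c \<theta>) * p2 (z \<rho> \<theta>))
    + Im (c \<theta>) * (Re (c \<theta>) * q1 (z \<rho> \<theta>) + Im (c \<theta>) * q2 (z \<rho> \<theta>))))"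
  define L where "L = (\<lambda>\<rho>. integral {0..2*pi} (\<lambda>\<theta>. p1 (z \<rho> \<theta>) + q2 (z \<rho> \<theta>)))"
  have dm: "(circ x0 w f has_vector_derivative N \<rho>) (at \<rho> within {0..t})" if "\<rho> \<in> {0..t}" for \<rho>
    using circ_deriv[OF f S w that] by (simp add: N_def c_def z_def)
  have dN: "(N has_vector_derivative N' \<rho>) (at \<rho> within {0..t})" if \<rho>: "\<rho> \<in> {0..t}" for \<rho>
  proof -
    have "((\<lambda>\<rho>. integral (cbox 0 (2*pi)) (\<lambda>\<theta>. Re (c \<theta>) * p (z \<rho> \<theta>) + Im (c \<theta>) * q (z \<rho> \<theta>))) has_vector_derivative
      integral (cbox 0 (2*pi)) ((\<lambda>\<rho> \<theta>. Re (c \<theta>) * (Re (c \<theta>) * p1 (z \<rho> \<theta>) + Im (c \<theta>) * p2 (z \<rho> \<theta>))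
    + Im (c \<theta>) * (Re (c \<theta>) * q1 (z \<rho> \<theta>) + Im (c \<theta>) * q2 (z \<rho> \<theta>))) \<rho>)) (at \<rho> within {0..t})"
    proof (rule leibniz_rule_vector_derivative)
      have cc2: "continuous_on ({0..t} \<times> cbox 0 (2*pi)) (\<lambda>x. h (z (fst x) (snd x)))" if "continuous_on S h" for h :: "complex \<Rightarrow> real"
        using continuous_on_radius_angle[OF that S w] by (simp add: z_def c_def case_prod_beta')
      have cC2: "continuous_on ({0..t} \<times> cbox 0 (2*pi)) (\<lambda>x. Re (c (snd x)))"
         "continuous_on ({0..t} \<times> cbox 0 (2*pi)) (\<lambda>x. Im (c (snd x)))"
        unfolding c_def by (intro continuous_intros)+
      show "continuous_on ({0..t} \<times> cbox 0 (2*pi)) (\<lambda>(\<rho>, \<theta>).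
          Re (c \<theta>) * (Re (c \<theta>) * p1 (z \<rho> \<theta>) + Im (c \<theta>) * p2 (z \<rho> \<theta>))
        + Im (c \<theta>) * (Re (c \<theta>) * q1 (z \<rho> \<theta>) + Im (c \<theta>) * q2 (z \<rho> \<theta>)))"
        unfolding case_prod_beta' by (intro continuous_intros cc2 cC2 c12)
      fix \<rho> :: real assume r: "\<rho> \<in> {0..t}"
      show "(\<lambda>\<theta>. Re (c \<theta>) * p (z \<rho> \<theta>) + Im (c \<theta>) * q (z \<rho> \<theta>)) integrable_on cbox 0 (2*pi)"
        unfolding box_real by (intro integrable_continuous_real continuous_intros cpq r)
      fix \<theta> :: real
      have zS: "x0 + of_real \<rho> * c \<theta> \<in> S" using zt[OF r] S by (auto simp: z_def)
      show "((\<lambda>\<rho>. Re (c \<theta>) * p (z \<rho> \<theta>) + Im (c \<theta>) * q (z \<rho> \<theta>)) has_vector_derivative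
         Re (c \<theta>) * (Re (c \<theta>) * p1 (z \<rho> \<theta>) + Im (c \<theta>) * p2 (z \<rho> \<theta>))
        + Im (c \<theta>) * (Re (c \<theta>) * q1 (z \<rho> \<theta>) + Im (c \<theta>) * q2 (z \<rho> \<theta>))) (at \<rho> within {0..t})"
        using has_vector_derivative_radius[OF p zS] has_vector_derivative_radius[OF q zS] unfolding z_def
        by (intro has_vector_derivative_add has_vector_derivative_mult_right) simp_all
    qed (use \<rho> in auto)
    then show ?thesis by (simp add: N_def[abs_def] N'_def)
  qed
  have parts: "N \<rho> + \<rho> * N' \<rho> = \<rho> * L \<rho>" if r: "\<rho> \<in> {0..t}" for \<rho>
  proof -
    note [continuous_intros] = cpq c12 r
    have zS: "x0 + of_real \<rho> * (w * cis \<theta>) \<in> S" for \<theta> using zt[OF r] S by (auto simp: z_def c_def)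
    \<comment> \<open>\<open>E\<close> is the tangential component of the gradient. It is periodic
      in \<theta>, so its derivative integrates to 0; adding that derivative to the radial terms
      leaves exactly the Laplacian.\<close>
    define E where "E = (\<lambda>\<theta>. - Im (c \<theta>) * p (z \<rho> \<theta>) + Re (c \<theta>) * q (z \<rho> \<theta>))"
    have dC: "((\<lambda>\<theta>. Re (c \<theta>)) has_real_derivative - Im (c \<theta>)) (at \<theta> within U)"
       "((\<lambda>\<theta>. Im (c \<theta>)) has_real_derivative Re (c \<theta>)) (at \<theta> within U)" for \<theta> U
      unfolding c_def by (auto intro!: derivative_eq_intros)
    have dp: "((\<lambda>\<theta>. p (z \<rho> \<theta>)) has_real_derivative \<rho> * (Re (c \<theta>) * p2 (z \<rho> \<theta>) - Im (c \<theta>) * p1 (z \<rho> \<theta>))) (at \<theta> within U)"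
      and dq: "((\<lambda>\<theta>. q (z \<rho> \<theta>)) has_real_derivative \<rho> * (Re (c \<theta>) * q2 (z \<rho> \<theta>) - Im (c \<theta>) * q1 (z \<rho> \<theta>))) (at \<theta> within U)" for \<theta> U
      using has_vector_derivative_angle[OF p zS] has_vector_derivative_angle[OF q zS]
      by (simp_all add: z_def c_def has_real_derivative_iff_has_vector_derivative)
    define E' where "E' = (\<lambda>\<theta>. - Re (c \<theta>) * p (z \<rho> \<theta>) - Im (c \<theta>) * q (z \<rho> \<theta>)
       + \<rho> * (- Im (c \<theta>) * (Re (c \<theta>) * p2 (z \<rho> \<theta>) - Im (c \<theta>) * p1 (z \<rho> \<theta>))
         + Re (c \<theta>) * (Re (c \<theta>) * q2 (z \<rho> \<theta>) - Im (c \<theta>) * q1 (z \<rho> \<theta>))))"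
    have "(E has_real_derivative E' \<theta>) (at \<theta> within {0..2*pi})" for \<theta>
      unfolding E_def[abs_def] E'_def
      by (rule derivative_eq_intros dC dp dq refl | simp)+ (simp add: algebra_simps)
    then have "(E' has_integral E (2*pi) - E 0) {0..2*pi}"
      by (intro fundamental_theorem_of_calculus) (auto simp: has_real_derivative_iff_has_vector_derivative)
    then have E0: "(E' has_integral 0) {0..2*pi}" by (simp add: E_def c_def z_def)
    have N: "((\<lambda>\<theta>. Re (c \<theta>) * p (z \<rho> \<theta>) + Im (c \<theta>) * q (z \<rho> \<theta>)) has_integral N \<rho>) {0..2*pi}"
      unfolding N_def by (intro integrable_integral integrable_continuous_real continuous_intros)
    have N': "((\<lambda>\<theta>. Re (c \<theta>) * (Re (c \<theta>) * p1 (z \<rho> \<theta>) + Im (c \<theta>) * p2 (z \<rho> \<theta>))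
    + Im (c \<theta>) * (Re (c \<theta>) * q1 (z \<rho> \<theta>) + Im (c \<theta>) * q2 (z \<rho> \<theta>))) has_integral N' \<rho>) {0..2*pi}"
      unfolding N'_def by (intro integrable_integral integrable_continuous_real continuous_intros)
    have L: "((\<lambda>\<theta>. p1 (z \<rho> \<theta>) + q2 (z \<rho> \<theta>)) has_integral L \<rho>) {0..2*pi}"
      unfolding L_def by (intro integrable_integral integrable_continuous_real continuous_intros)
    have "((\<lambda>\<theta>. \<rho> * (p1 (z \<rho> \<theta>) + q2 (z \<rho> \<theta>))) has_integral (N \<rho> + \<rho> * N' \<rho> + 0)) {0..2*pi}"
    proof (rule has_integral_eq[OF _ has_integral_add[OF has_integral_add[OF N has_integral_mult_right[OF N', of \<rho>]] E0]])
      fix \<theta>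
      define A B where "A = Re (c \<theta>)" and "B = Im (c \<theta>)"
      have AB: "A * A + B * B = 1" using cc[of \<theta>] by (simp add: A_def B_def)
      have "A * P + B * Q + \<rho> * (A * (A * P1 + B * P2) + B * (A * Q1 + B * Q2))
          + (- A * P - B * Q + \<rho> * (- B * (A * P2 - B * P1) + A * (A * Q2 - B * Q1)))
          = \<rho> * ((A * A + B * B) * (P1 + Q2))" for P Q P1 P2 Q1 Q2
        by (simp add: algebra_simps)
      note this[unfolded AB]
      then show "Re (c \<theta>) * p (z \<rho> \<theta>) + Im (c \<theta>) * q (z \<rho> \<theta>) +
         \<rho> * (Re (c \<theta>) * (Re (c \<theta>) * p1 (z \<rho> \<theta>) + Im (c \<theta>) * p2 (z \<rho> \<theta>)) +
          Im (c \<theta>) * (Re (c \<theta>) * q1 (z \<rho> \<theta>) + Im (c \<theta>) * q2 (z \<rho> \<theta>))) + E' \<theta> =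
         \<rho> * (p1 (z \<rho> \<theta>) + q2 (z \<rho> \<theta>))"
        unfolding E'_def A_def[symmetric] B_def[symmetric]
        by simp
    qed
    from has_integral_unique[OF this has_integral_mult_right[OF L, of \<rho>]] show ?thesis by simp
  qed
  have Lge: "L \<rho> \<ge> - K * (2*pi)" if "\<rho> \<in> {0..t}" for \<rho>
  proof -
    have "integral {0..2*pi} (\<lambda>\<theta>. - K) \<le> L \<rho>" unfolding L_def
      by (rule integral_le) (use K zt[OF that] c12 that in \<open>auto intro!: integrable_continuous_real continuous_intros\<close>)
    then show ?thesis by (simp add: mult.commute)
  qed
  have real_deriv: "(g has_real_derivative g') (at s)"
    if "(g has_vector_derivative g') (at s within {0..t})" "0 < s" "s < t" for g g' s
  proof -
    have "at s within {0..t} = at s"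
      by (rule at_within_interior) (use that in \<open>simp add: interior_atLeastAtMost_real\<close>)
    then show ?thesis using that by (simp add: has_real_derivative_iff_has_vector_derivative)
  qed
  have cN: "continuous_on {0..t} N" and cm: "continuous_on {0..t} (circ x0 w f)"
    by (rule continuous_on_vector_derivative, erule dN, rule continuous_on_vector_derivative, erule dm)
  \<comment> \<open>By \<open>parts\<close> the derivative of \<open>s * N s\<close> is
    \<open>s * L s\<close>, at least \<open>- 2 * pi * K * s\<close>. The factor s gives the value 0
    at the centre, and dividing by it afterwards yields the bound for \<open>N\<close>.\<close>
  have Nge: "N s \<ge> - K * pi * s" if s: "0 < s" "s < t" for s
  proof -
    have "0 * N 0 + K * pi * 0\<^sup>2 \<le> s * N s + K * pi * s\<^sup>2"
    proof (rule DERIV_nonneg_imp_increasing_open[where f="\<lambda>s. s * N s + K * pi * s\<^sup>2"])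
      show "continuous_on {0..s} (\<lambda>s. s * N s + K * pi * s\<^sup>2)"
        using s by (intro continuous_intros continuous_on_subset[OF cN]) auto
      fix x assume x: "0 < x" "x < s"
      have "((\<lambda>s. s * N s + K * pi * s\<^sup>2) has_real_derivative (N x + x * N' x + K * pi * (2 * x))) (at x)"
        using real_deriv[OF dN] x s by (auto intro!: derivative_eq_intros)
      moreover have "N x + x * N' x + K * pi * (2 * x) \<ge> 0"
      proof -
        have "x * L x \<ge> x * (- K * (2*pi))" using Lge[of x] x s by (intro mult_left_mono) auto
        then show ?thesis using parts[of x] x s by (simp add: algebra_simps)
      qed
      ultimately show "\<exists>y. ((\<lambda>s. s * N s + K * pi * s\<^sup>2) has_real_derivative y) (at x) \<and> 0 \<le> y" by blast
    qed (use s in auto)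
    then have "s * (N s + K * pi * s) \<ge> 0" by (simp add: algebra_simps power2_eq_square)
    then show ?thesis using s by (simp add: zero_le_mult_iff)
  qed
  have "circ x0 w f 0 + K * pi * 0\<^sup>2 / 2 \<le> circ x0 w f \<rho> + K * pi * \<rho>\<^sup>2 / 2"
  proof (cases "\<rho> = 0")
    case False
    show ?thesis
    proof (rule DERIV_nonneg_imp_increasing_open[where f="\<lambda>\<rho>. circ x0 w f \<rho> + K * pi * \<rho>\<^sup>2 / 2"])
      show "continuous_on {0..\<rho>} (\<lambda>\<rho>. circ x0 w f \<rho> + K * pi * \<rho>\<^sup>2 / 2)"
        using \<rho> by (intro continuous_intros continuous_on_subset[OF cm]) auto
      fix x assume x: "0 < x" "x < \<rho>"
      have "((\<lambda>\<rho>. circ x0 w f \<rho> + K * pi * \<rho>\<^sup>2 / 2) has_real_derivative (N x + K * pi * x)) (at x)"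
        using real_deriv[OF dm] x \<rho> by (auto intro!: derivative_eq_intros)
      moreover have "N x + K * pi * x \<ge> 0" using Nge[of x] x \<rho> by auto
      ultimately show "\<exists>y. ((\<lambda>\<rho>. circ x0 w f \<rho> + K * pi * \<rho>\<^sup>2 / 2) has_real_derivative y) (at x) \<and> 0 \<le> y" by blast
    qed (use \<rho> in auto)
  qed simp
  then show ?thesis by (simp add: circ_0 algebra_simps)
qed

subsection \<open>Interior estimates\<close>

lemma polar_unit:
  obtains w :: complex where "cmod w = 1" "z = of_real (cmod z) * w"
proof (cases "z = 0")
  case False
  have "z = of_real (cmod z) * sgn z" using False by (simp add: sgn_div_norm scaleR_conv_of_real)
  moreover have "cmod (sgn z) = 1" using False by (simp add: norm_sgn)
  ultimately show ?thesis using that by blast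
qed (use that[of 1] in auto)

lemma continuous_on_circle_point:
  assumes "continuous_on S f" "cball x0 t \<subseteq> S" "z \<in> cball 0 t"
  shows "continuous_on A (\<lambda>\<theta>. f (x0 + z * cis \<theta>))"
  by (rule continuous_on_compose2[OF assms(1)])
     (use assms(2,3) in \<open>auto intro!: continuous_intros simp: subset_iff dist_norm norm_mult\<close>)

section \<open>A calculus for the Laplacian and its mean value inequalities\<close>

text \<open>A relation with hidden witnesses for the derivatives: it is closed under sums and
  multiples and also covers the explicit logarithm of \<open>has_laplacian_log\<close>.\<close>

definition has_laplacian :: "complex set \<Rightarrow> (complex \<Rightarrow> real) \<Rightarrow> (complex \<Rightarrow> real) \<Rightarrow> bool" where
  "has_laplacian S f l \<longleftrightarrow> (\<exists>p q p1 p2 q1 q2. has_partials S f p q \<and> has_partials S p p1 p2 \<and> has_partials S q q1 q2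
      \<and> (\<forall>x\<in>S. l x = p1 x + q2 x))"

lemma has_partials_linear:
  assumes f: "has_partials S f f1 f2" and T: "bounded_linear T"
  shows "has_partials S (\<lambda>x. T (f x)) (\<lambda>x. T (f1 x)) (\<lambda>x. T (f2 x))"
proof -
  interpret T: bounded_linear T by fact
  have "((\<lambda>x. T (f x)) has_derivative (\<lambda>h. Re h *\<^sub>R T (f1 x) + Im h *\<^sub>R T (f2 x))) (at x)" if "x \<in> S" for x
    using T.has_derivative[OF has_partials_D[OF f that]] by (simp add: T.add T.scaleR)
  then show ?thesis using f by (auto simp: has_partials_def intro: T.continuous_on)
qed

lemma has_partials_add:
  assumes "has_partials S f f1 f2" "has_partials S g g1 g2"
  shows "has_partials S (\<lambda>x. f x + g x) (\<lambda>x. f1 x + g1 x) (\<lambda>x. f2 x + g2 x)"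
proof -
  have "((\<lambda>x. f x + g x) has_derivative (\<lambda>h. Re h *\<^sub>R (f1 x + g1 x) + Im h *\<^sub>R (f2 x + g2 x))) (at x)" if "x \<in> S" for x
    using has_derivative_add[OF has_partials_D[OF assms(1) that] has_partials_D[OF assms(2) that]]
    by (simp add: algebra_simps)
  then show ?thesis using assms by (auto simp: has_partials_def intro: continuous_on_add)
qed

lemma has_laplacianI:
  "has_partials S f p q \<Longrightarrow> has_partials S p p1 p2 \<Longrightarrow> has_partials S q q1 q2 \<Longrightarrow>
    (\<And>x. x \<in> S \<Longrightarrow> l x = p1 x + q2 x) \<Longrightarrow> has_laplacian S f l"
  unfolding has_laplacian_def by blast

lemma has_laplacian_add:
  assumes "has_laplacian S f l" "has_laplacian S g m"
  shows "has_laplacian S (\<lambda>x. f x + g x) (\<lambda>x. l x + m x)"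
proof -
  obtain p q p1 p2 q1 q2 where 1: "has_partials S f p q" "has_partials S p p1 p2" "has_partials S q q1 q2"
      "\<forall>x\<in>S. l x = p1 x + q2 x" using assms(1) unfolding has_laplacian_def by blast
  obtain r s r1 r2 s1 s2 where 2: "has_partials S g r s" "has_partials S r r1 r2" "has_partials S s s1 s2"
      "\<forall>x\<in>S. m x = r1 x + s2 x" using assms(2) unfolding has_laplacian_def by blast
  show ?thesis
    by (rule has_laplacianI[OF has_partials_add[OF 1(1) 2(1)] has_partials_add[OF 1(2) 2(2)] has_partials_add[OF 1(3) 2(3)]])
       (use 1(4) 2(4) in auto)
qed

lemma has_laplacian_cmult:
  assumes "has_laplacian S f l"
  shows "has_laplacian S (\<lambda>x. c * f x) (\<lambda>x. c * l x)"
proof -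
  obtain p q p1 p2 q1 q2 where 1: "has_partials S f p q" "has_partials S p p1 p2" "has_partials S q q1 q2"
      "\<forall>x\<in>S. l x = p1 x + q2 x" using assms(1) unfolding has_laplacian_def by blast
  note L = has_partials_linear[OF _ bounded_linear_mult_right[of c]]
  show ?thesis
    by (rule has_laplacianI[OF L[OF 1(1)] L[OF 1(2)] L[OF 1(3)]]) (use 1(4) in \<open>auto simp: algebra_simps\<close>)
qed

lemma has_laplacian_const: "has_laplacian S (\<lambda>x. c) (\<lambda>x. 0)"
proof -
  have "has_partials S (\<lambda>x. d) (\<lambda>x. 0) (\<lambda>x. 0)" for d :: real by (auto simp: has_partials_def)
  then show ?thesis unfolding has_laplacian_def by force
qed

lemma C2_on_has_laplacian:
  assumes "C2_on S f" shows "has_laplacian S f (laplacian f)"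
  using assms C1_on_has_partials unfolding C2_on_def has_laplacian_def laplacian_def by blast

lemma has_laplacian_continuous: "has_laplacian S f l \<Longrightarrow> continuous_on S f"
  unfolding has_laplacian_def using has_partials_continuous_on by blast

lemma laplacian_mean_lower:
  assumes f: "has_laplacian S f l" and S: "cball x0 t \<subseteq> S"
    and K: "\<And>x. x \<in> cball x0 t \<Longrightarrow> l x \<ge> - K" and z: "z \<in> cball 0 t"
  shows "2 * pi * (f x0 - K * (cmod z)\<^sup>2 / 4) \<le> integral {0..2*pi} (\<lambda>\<theta>. f (x0 + z * cis \<theta>))"
proof -
  obtain p q p1 p2 q1 q2 where 1: "has_partials S f p q" "has_partials S p p1 p2" "has_partials S q q1 q2"
      "\<forall>x\<in>S. l x = p1 x + q2 x" using f unfolding has_laplacian_def by blast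
  obtain w where w: "cmod w = 1" "z = of_real (cmod z) * w" using polar_unit by blast
  have e: "x0 + complex_of_real (cmod z) * (w * cis \<theta>) = x0 + z * cis \<theta>" for \<theta>
    using w(2) by (metis mult.assoc)
  have "2 * pi * (f x0 - K * (cmod z)\<^sup>2 / 4) \<le> circ x0 w f (cmod z)"
    by (rule laplacian_circle_mean[OF 1(1-3) S w(1)]) (use K 1(4) S z in \<open>force+\<close>)
  then show ?thesis unfolding circ_def e .
qed

lemma laplacian_mean_upper:
  assumes f: "has_laplacian S f l" and S: "cball x0 t \<subseteq> S"
    and K: "\<And>x. x \<in> cball x0 t \<Longrightarrow> l x \<le> K" and z: "z \<in> cball 0 t"
  shows "integral {0..2*pi} (\<lambda>\<theta>. f (x0 + z * cis \<theta>)) \<le> 2 * pi * (f x0 + K * (cmod z)\<^sup>2 / 4)"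
proof -
  have "2 * pi * (-1 * f x0 - K * (cmod z)\<^sup>2 / 4) \<le> integral {0..2*pi} (\<lambda>\<theta>. -1 * f (x0 + z * cis \<theta>))"
    by (rule laplacian_mean_lower[OF has_laplacian_cmult[OF f] S _ z]) (use K in auto)
  then show ?thesis by (simp add: algebra_simps)
qed

text \<open>The circle integral of g differs from \<open>2 * pi * g x0\<close> by at most
  \<open>2 * pi * K * t\<close>, and its modulus is at most the integral of the modulus. The norm
  thus moves inside, where the energy can control it.\<close>

lemma dbar_mean:
  assumes g: "has_partials S g g1 g2" and S: "cball x0 t \<subseteq> S"
    and K: "\<And>x. x \<in> cball x0 t \<Longrightarrow> cmod (g1 x + \<i> * g2 x) \<le> K" and z: "z \<in> cball 0 t"
  shows "2 * pi * (cmod (g x0) - K * t) \<le> integral {0..2*pi} (\<lambda>\<theta>. cmod (g (x0 + z * cis \<theta>)))"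
proof -
  obtain w where w: "cmod w = 1" "z = of_real (cmod z) * w" using polar_unit by blast
  have e: "x0 + complex_of_real (cmod z) * (w * cis \<theta>) = x0 + z * cis \<theta>" for \<theta>
    using w(2) by (metis mult.assoc)
  have K0: "K \<ge> 0" using K[of x0] z by (auto intro: order_trans[OF norm_ge_zero] order_trans[OF norm_ge_zero[of z]])
  have "cmod (circ x0 w g (cmod z) - (2*pi) *\<^sub>R g x0) \<le> 2 * pi * K * cmod z"
    by (rule dbar_circle_mean[OF g S w(1) K]) (use z in auto)
  then have 1: "cmod (integral {0..2*pi} (\<lambda>\<theta>. g (x0 + z * cis \<theta>)) - (2*pi) *\<^sub>R g x0) \<le> 2 * pi * K * cmod z"
    unfolding circ_def e .
  have "cmod ((2*pi) *\<^sub>R g x0) \<le> cmod (integral {0..2*pi} (\<lambda>\<theta>. g (x0 + z * cis \<theta>))) + 2 * pi * K * cmod z"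
    using 1 norm_triangle_ineq2[of "(2*pi) *\<^sub>R g x0" "integral {0..2*pi} (\<lambda>\<theta>. g (x0 + z * cis \<theta>))"]
    by (simp only: norm_minus_commute)
  moreover have "cmod ((2*pi) *\<^sub>R g x0) = 2 * pi * cmod (g x0)" by simp
  moreover have "2 * pi * K * cmod z \<le> 2 * pi * K * t" using K0 z by (intro mult_left_mono) auto
  moreover have "cmod (integral {0..2*pi} (\<lambda>\<theta>. g (x0 + z * cis \<theta>))) \<le> integral {0..2*pi} (\<lambda>\<theta>. cmod (g (x0 + z * cis \<theta>)))"
    using continuous_on_circle_point[OF has_partials_continuous_on[OF g] S z]
    by (intro integral_norm_bound_integral integrable_continuous_real continuous_intros) auto
  ultimately show ?thesis by (simp add: algebra_simps)
qed

section \<open>Harnack inequality and pointwise bounds by point picking\<close>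

text \<open>The disc of radius s about y lies in the disc of radius \<open>3 * s\<close> about z,
  and v is nonnegative, so the solid means compare with the ratio 9 of the areas. The errors are
  \<open>K * s\<^sup>2 / 4\<close> at y and 9 times \<open>9 * K * s\<^sup>2 / 4\<close> at z, in
  total below \<open>21 * K * s\<^sup>2\<close>.\<close>

lemma harnack_ball:
  assumes v: "has_laplacian S v l" and S: "ball x (4* s) \<subseteq> S" and s: "s > 0"
    and pos: "\<And>y. y \<in> ball x (4* s) \<Longrightarrow> v y \<ge> 0"
    and K: "\<And>y. y \<in> ball x (4* s) \<Longrightarrow> \<bar>l y\<bar> \<le> K"
    and y: "y \<in> ball x s" and z: "z \<in> ball x s"
  shows "v y \<le> 9 * v z + 21 * K * s\<^sup>2"
proof -
  have K0: "K \<ge> 0" using K[of x] s by force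
  have sub: "cball y s \<subseteq> ball x (4* s)" "ball z (3* s) \<subseteq> ball x (4* s)" "ball y s \<subseteq> ball z (3* s)"
    using y z s by (auto simp: subset_iff) metric+
  have c: "continuous_on (ball x (4* s)) v" using has_laplacian_continuous[OF v] S continuous_on_subset by blast
  have 1: "ennreal (2*pi*(v y - K* s\<^sup>2/4) * (pi * s\<^sup>2)) \<le> ennreal (2*pi) * (\<integral>\<^sup>+x\<in>ball y s. ennreal (v x) \<partial>lborel)"
  proof (rule solid_mean_lower)
    fix w assume w: "w \<in> ball (0::complex) s"
    have "2 * pi * (v y - K * (cmod w)\<^sup>2 / 4) \<le> integral {0..2*pi} (\<lambda>\<theta>. v (y + w * cis \<theta>))"
    proof (rule laplacian_mean_lower[OF v, where t=s])
      show "- K \<le> l u" if "u \<in> cball y s" for u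
        using K[of u] sub(1) that by (auto simp: abs_le_iff)
    qed (use sub S w in auto)
    moreover have "K * (cmod w)\<^sup>2 \<le> K * s\<^sup>2" using w K0 by (intro mult_left_mono power_mono) auto
    then have "2 * pi * (v y - K * s\<^sup>2 / 4) \<le> 2 * pi * (v y - K * (cmod w)\<^sup>2 / 4)" by simp
    ultimately show "2*pi*(v y - K* s\<^sup>2/4) \<le> integral {0..2*pi} (\<lambda>\<theta>. v (y + w * cis \<theta>))" by linarith
  next
    show "continuous_on (ball y s) v" by (rule continuous_on_subset[OF c]) (use sub in force)
    show "0 \<le> v u" if "u \<in> ball y s" for u by (rule pos) (use sub that in fastforce)
  qed (use s in simp)
  have 2: "ennreal (2*pi) * (\<integral>\<^sup>+x\<in>ball z (3* s). ennreal (v x) \<partial>lborel) \<le> ennreal (2*pi*(v z + 9*K* s\<^sup>2/4) * (pi * (3* s)\<^sup>2))"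
  proof (rule solid_mean_upper)
    fix w assume w: "w \<in> ball (0::complex) (3* s)"
    have wz: "cball z (cmod w) \<subseteq> ball x (4* s)"
      using w z s by (auto simp: subset_iff) metric
    have "integral {0..2*pi} (\<lambda>\<theta>. v (z + w * cis \<theta>)) \<le> 2 * pi * (v z + K * (cmod w)\<^sup>2 / 4)"
    proof (rule laplacian_mean_upper[OF v, where t="cmod w"])
      show "l u \<le> K" if "u \<in> cball z (cmod w)" for u
        using K[of u] wz that by (auto simp: abs_le_iff)
    qed (use wz S in auto)
    moreover have "K * (cmod w)\<^sup>2 \<le> K * (3* s)\<^sup>2" using w K0 by (intro mult_left_mono power_mono) auto
    then have "2 * pi * (v z + K * (cmod w)\<^sup>2 / 4) \<le> 2 * pi * (v z + 9 * K * s\<^sup>2 / 4)" by (simp add: power_mult_distrib)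
    ultimately show "integral {0..2*pi} (\<lambda>\<theta>. v (z + w * cis \<theta>)) \<le> 2*pi*(v z + 9*K* s\<^sup>2/4)" by linarith
  next
    show "continuous_on (ball z (3 * s)) v" by (rule continuous_on_subset[OF c]) (use sub in force)
    show "0 \<le> v u" if "u \<in> ball z (3 * s)" for u by (rule pos) (use sub that in fastforce)
  qed (use s in simp)
  have "(\<integral>\<^sup>+x\<in>ball y s. ennreal (v x) \<partial>lborel) \<le> (\<integral>\<^sup>+x\<in>ball z (3* s). ennreal (v x) \<partial>lborel)"
    by (rule nn_integral_mono) (use sub(3) in \<open>auto simp: indicator_def\<close>)
  then have "ennreal (2*pi*(v y - K* s\<^sup>2/4) * (pi * s\<^sup>2)) \<le> ennreal (2*pi*(v z + 9*K* s\<^sup>2/4) * (pi * (3* s)\<^sup>2))"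
    using 1 2 by (meson mult_left_mono order_trans zero_le)
  moreover have "0 \<le> 2*pi*(v z + 9*K* s\<^sup>2/4) * (pi * (3* s)\<^sup>2)"
    using pos[of z] z s K0 by (intro mult_nonneg_nonneg add_nonneg_nonneg) (auto simp: dist_norm)
  ultimately have "2*pi*(v y - K* s\<^sup>2/4) * (pi * s\<^sup>2) \<le> 2*pi*(v z + 9*K* s\<^sup>2/4) * (pi * (3* s)\<^sup>2)"
    by (simp add: ennreal_le_iff)
  then have "(2*pi*pi* s\<^sup>2) * (v y - K* s\<^sup>2/4) \<le> (2*pi*pi* s\<^sup>2) * (9 * (v z + 9*K* s\<^sup>2/4))"
    by (simp add: power_mult_distrib algebra_simps)
  then have "v y - K* s\<^sup>2/4 \<le> 9 * (v z + 9*K* s\<^sup>2/4)"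
    by (rule mult_left_le_imp_le) (use s in simp)
  moreover have "K * s\<^sup>2 \<ge> 0" using K0 by simp
  ultimately show ?thesis by (simp add: field_simps)
qed

text \<open>At a maximum point \<open>x0\<close> of the weighted density, \<open>exp (2 w)\<close> is at most \<open>4 A\<close>, where \<open>A\<close> is its
  value at \<open>x0\<close>, on a ball of radius larger than \<open>(k A) powr (- 1/2)\<close> if the claim fails. The
  mean value inequality for \<open>w\<close> and Jensen's inequality then contradict the small mass.\<close>
lemma eps_regularity:
  assumes w: "has_laplacian S w l" and S: "cball x1 \<delta> \<subseteq> S" and \<delta>: "\<delta> > 0" and k: "k > 0"
    and l: "\<And>x. x \<in> cball x1 \<delta> \<Longrightarrow> l x \<ge> - k * exp (2 * w x)"
    and mass: "(\<integral>\<^sup>+x\<in>ball x1 \<delta>. ennreal (exp (2 * w x)) \<partial>lborel) \<le> ennreal \<epsilon>"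
    and \<epsilon>: "\<epsilon> \<ge> 0" "k * \<epsilon> < pi * exp (-2)" and x: "x \<in> cball x1 \<delta>"
  shows "(\<delta> - dist x1 x)\<^sup>2 * exp (2 * w x) \<le> 4 / k"
proof -
  define \<phi> where "\<phi> = (\<lambda>x. exp (2 * w x))"
  define H where "H = (\<lambda>x. (\<delta> - dist x1 x)\<^sup>2 * \<phi> x)"
  have cw: "continuous_on (cball x1 \<delta>) w" using has_laplacian_continuous[OF w] S continuous_on_subset by blast
  then have "continuous_on (cball x1 \<delta>) H" unfolding H_def \<phi>_def by (intro continuous_intros)
  then obtain x0 where x0: "x0 \<in> cball x1 \<delta>" "\<And>x. x \<in> cball x1 \<delta> \<Longrightarrow> H x \<le> H x0"
    using continuous_attains_sup[of "cball x1 \<delta>" H] \<delta> by auto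
  have "H x0 \<le> 4 / k"
  proof (rule ccontr)
    assume neg: "\<not> H x0 \<le> 4 / k"
    define A where "A = \<phi> x0"
    have A: "A > 0" by (simp add: A_def \<phi>_def)
    define \<rho> where "\<rho> = (\<delta> - dist x1 x0) / 2"
    have H0: "H x0 = 4 * \<rho>\<^sup>2 * A" by (simp add: H_def \<rho>_def A_def power_divide)
    have \<rho>: "\<rho> > 0" using neg x0(1) k H0 by (cases "\<rho> = 0") (auto simp: \<rho>_def)
    define t where "t = sqrt (1 / (k * A))"
    \<comment> \<open>With \<open>k * A * t\<^sup>2 = 1\<close> and density at most
      \<open>4 * A\<close> on the disc, the Laplacian is at least \<open>- 4 * k * A\<close>, and
      the circle mean of w loses at most 1. Failure of the claim says
      \<open>4 * \<rho>\<^sup>2 * A > 4 / k\<close>, which is t < \<rho>.\<close>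
    have t: "t > 0" "t\<^sup>2 = 1 / (k * A)" using k A by (simp_all add: t_def)
    have "t\<^sup>2 < \<rho>\<^sup>2" using neg k A unfolding t(2) H0 by (simp add: field_simps)
    then have t\<rho>: "t < \<rho>" using \<rho> by (simp add: power_less_imp_less_base)
    \<comment> \<open>The distance of \<open>x0\<close> to the boundary is
      \<open>2 * \<rho>\<close>, and moving by less than \<rho> keeps at least half of it; squaring
      gives the factor 4.\<close>
    have bx: "x \<in> ball x1 \<delta> \<and> \<phi> x \<le> 4 * A" if "x \<in> cball x0 t" for x
    proof -
      have d: "dist x1 x \<le> \<delta> - \<rho>"
        using that t\<rho> dist_triangle[of x1 x x0] \<rho>_def by (simp add: dist_commute field_simps)
      then have "\<rho>\<^sup>2 * \<phi> x \<le> H x" unfolding H_def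
        by (intro mult_right_mono power_mono) (use \<rho> in \<open>auto simp: \<phi>_def\<close>)
      also have "\<dots> \<le> 4 * \<rho>\<^sup>2 * A" using x0(2)[of x] d \<rho> H0 by simp
      finally have "\<rho>\<^sup>2 * \<phi> x \<le> \<rho>\<^sup>2 * (4 * A)" by (simp add: mult_ac)
      then have "\<phi> x \<le> 4 * A" by (rule mult_left_le_imp_le) (use \<rho> in simp)
      then show ?thesis using d \<rho> by simp
    qed
    have tS: "cball x0 t \<subseteq> ball x1 \<delta>" "cball x0 t \<subseteq> S" "ball x0 t \<subseteq> ball x1 \<delta>"
      using bx S by (force simp: subset_iff)+
    have "ennreal (2*pi*(A * exp (-2)) * (pi * t\<^sup>2)) \<le> ennreal (2*pi) * (\<integral>\<^sup>+x\<in>ball x0 t. ennreal (\<phi> x) \<partial>lborel)"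
    proof (rule solid_mean_lower)
      show "continuous_on (ball x0 t) \<phi>" unfolding \<phi>_def
        by (intro continuous_intros continuous_on_subset[OF cw]) (use tS in force)
      fix z assume z: "z \<in> ball (0::complex) t"
      have cf: "continuous_on {0..2*pi} (\<lambda>\<theta>. w (x0 + z * cis \<theta>))"
        by (rule continuous_on_circle_point[OF has_laplacian_continuous[OF w] tS(2)]) (use z in auto)
      have lK: "l x \<ge> - (4 * k * A)" if "x \<in> cball x0 t" for x
      proof -
        have "l x \<ge> - (k * \<phi> x)" using l[of x] bx[OF that] by (simp add: \<phi>_def)
        moreover have "k * \<phi> x \<le> k * (4 * A)" using bx[OF that] k by (intro mult_left_mono) auto
        ultimately show ?thesis by linarith
      qed
      have "2 * pi * (w x0 - (4*k*A) * (cmod z)\<^sup>2 / 4) \<le> integral {0..2*pi} (\<lambda>\<theta>. w (x0 + z * cis \<theta>))"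
        by (rule laplacian_mean_lower[OF w tS(2)]) (use lK z in auto)
      moreover have "(4*k*A) * (cmod z)\<^sup>2 / 4 \<le> 1"
      proof -
        have "(cmod z)\<^sup>2 \<le> t\<^sup>2" using z by (intro power_mono) auto
        then have "k * A * (cmod z)\<^sup>2 \<le> k * A * (1 / (k * A))" unfolding t(2) using k A by (intro mult_left_mono) auto
        then show ?thesis using k A by simp
      qed
      then have "2 * pi * (w x0 - (4*k*A) * (cmod z)\<^sup>2 / 4) \<ge> 2 * pi * (w x0 - 1)" by (intro mult_left_mono) auto
      ultimately have m: "2 * pi * (w x0 - 1) \<le> integral {0..2*pi} (\<lambda>\<theta>. w (x0 + z * cis \<theta>))" by linarith
      \<comment> \<open>c bounds the mean of \<open>2 * w\<close> from below; Jensen's inequality is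
        obtained from the tangent line of the exponential at c.\<close>
      define c where "c = 2 * w x0 - 2"
      have "2 * pi * exp c \<le> exp c * (2 * pi * (1 - c) + 2 * integral {0..2*pi} (\<lambda>\<theta>. w (x0 + z * cis \<theta>)))"
      proof -
        have "2 * pi * 1 \<le> 2 * pi * (1 - c) + 2 * integral {0..2*pi} (\<lambda>\<theta>. w (x0 + z * cis \<theta>))"
          using m unfolding c_def by (simp add: algebra_simps)
        from mult_left_mono[OF this, of "exp c"] show ?thesis by (simp add: mult_ac)
      qed
      also have "\<dots> = integral {0..2*pi} (\<lambda>\<theta>. exp c * ((1 - c) + 2 * w (x0 + z * cis \<theta>)))"
        using cf by (subst integral_mult_right, subst Henstock_Kurzweil_Integration.integral_add)
          (auto intro!: integrable_continuous_real continuous_intros)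
      also have "\<dots> \<le> integral {0..2*pi} (\<lambda>\<theta>. \<phi> (x0 + z * cis \<theta>))"
      proof (rule integral_le)
        fix \<theta>
        have "exp c * (1 + (2 * w (x0 + z * cis \<theta>) - c)) \<le> exp c * exp (2 * w (x0 + z * cis \<theta>) - c)"
          by (intro mult_left_mono exp_ge_add_one_self) auto
        also have "\<dots> = \<phi> (x0 + z * cis \<theta>)" by (simp add: \<phi>_def flip: exp_add)
        finally show "exp c * ((1 - c) + 2 * w (x0 + z * cis \<theta>)) \<le> \<phi> (x0 + z * cis \<theta>)"
          by (simp add: algebra_simps)
      qed (use cf in \<open>auto simp: \<phi>_def intro!: integrable_continuous_real continuous_intros\<close>)
      finally show "2*pi*(A * exp (-2)) \<le> integral {0..2*pi} (\<lambda>\<theta>. \<phi> (x0 + z * cis \<theta>))"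
        by (simp add: A_def \<phi>_def c_def exp_diff exp_minus field_simps)
    qed (use t in \<open>auto simp: \<phi>_def\<close>)
    also have "\<dots> \<le> ennreal (2*pi) * (\<integral>\<^sup>+x\<in>ball x1 \<delta>. ennreal (\<phi> x) \<partial>lborel)"
      by (intro mult_left_mono nn_integral_mono) (use tS(3) in \<open>auto simp: indicator_def\<close>)
    also have "\<dots> \<le> ennreal (2*pi) * ennreal \<epsilon>"
      unfolding \<phi>_def by (intro mult_left_mono mass) auto
    also have "\<dots> = ennreal (2*pi*\<epsilon>)" using \<epsilon> by (simp add: ennreal_mult)
    finally have "2*pi*(A * exp (-2)) * (pi * t\<^sup>2) \<le> 2*pi*\<epsilon>" using \<epsilon> by (simp add: ennreal_le_iff)
    then have "2*pi*((A * exp (-2)) * (pi * t\<^sup>2)) \<le> 2*pi*\<epsilon>" by (simp only: mult.assoc)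
    then have "(A * exp (-2)) * (pi * t\<^sup>2) \<le> \<epsilon>" by (rule mult_left_le_imp_le) simp
    then have "pi * exp (-2) \<le> k * \<epsilon>" unfolding t(2) using k A by (simp add: field_simps)
    then show False using \<epsilon> by simp
  qed
  then show ?thesis using x0(2)[OF x] by (simp add: H_def \<phi>_def)
qed

lemma le_one_plus_power4: "(s::real) \<ge> 0 \<Longrightarrow> s \<le> 1 + s ^ 4"
  using self_le_power[of s 4] zero_le_power[of s 4] by linarith

text \<open>Point picking again: near a maximum point \<open>x0\<close> of \<open>H\<close> the norm
  is at most \<open>4 * A\<close>, so the Cauchy-Riemann expressions of both components are at most
  \<open>4 * M * A\<close>. On a disc of radius t this costs \<open>4 * M * A * t\<close> per
  component, which small t absorbs into A. What remains is the energy over the area of the disc. As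
  the equation is linear in the spinor once M is fixed, no smallness of the energy enters.\<close>

lemma dirac_bound:
  fixes f g :: "complex \<Rightarrow> complex"
  defines "N \<equiv> (\<lambda>x. norm (f x, g x))"
  assumes f: "has_partials S f f1 f2" and g: "has_partials S g g1 g2"
    and S: "cball x1 \<delta> \<subseteq> S" and \<delta>: "\<delta> > 0" and M: "M > 0" and C: "C \<ge> 0"
    and eqf: "\<And>x. x \<in> ball x1 \<delta> \<Longrightarrow> cmod (f1 x - \<i> * f2 x) \<le> M * N x"
    and eqg: "\<And>x. x \<in> ball x1 \<delta> \<Longrightarrow> cmod (g1 x + \<i> * g2 x) \<le> M * N x"
    and energy: "(\<integral>\<^sup>+x\<in>ball x1 \<delta>. ennreal ((N x) ^ 4) \<partial>lborel) \<le> ennreal C"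
    and x: "x \<in> cball x1 \<delta>"
  shows "(\<delta> - dist x1 x)\<^sup>2 * N x \<le> 16 * \<delta>\<^sup>2 + 16 * C / pi * (4 + 256 * M\<^sup>2 * \<delta>\<^sup>2)"
proof -
  define H where "H = (\<lambda>x. (\<delta> - dist x1 x)\<^sup>2 * N x)"
  have cN: "continuous_on S N" unfolding N_def
    by (intro continuous_intros has_partials_continuous_on[OF f] has_partials_continuous_on[OF g])
  then have "continuous_on (cball x1 \<delta>) H" unfolding H_def
    by (intro continuous_intros continuous_on_subset[OF cN S])
  then obtain x0 where x0: "x0 \<in> cball x1 \<delta>" "\<And>x. x \<in> cball x1 \<delta> \<Longrightarrow> H x \<le> H x0"
    using continuous_attains_sup[of "cball x1 \<delta>" H] \<delta> by auto
  have N0: "N x \<ge> 0" for x by (simp add: N_def)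
  define A where "A = N x0"
  define \<rho> where "\<rho> = (\<delta> - dist x1 x0) / 2"
  have H0: "H x0 = 4 * \<rho>\<^sup>2 * A" by (simp add: H_def \<rho>_def A_def power_divide)
  have "H x0 \<le> 16 * \<delta>\<^sup>2 + 16 * C / pi * (4 + 256 * M\<^sup>2 * \<delta>\<^sup>2)"
  proof (cases "\<rho> = 0")
    case True
    then show ?thesis using H0 C by simp
  next
    case False
    moreover have "\<rho> \<ge> 0" using x0(1) by (simp add: \<rho>_def)
    moreover have "\<rho> \<le> \<delta>" using \<delta> by (simp add: \<rho>_def field_simps add_increasing)
    ultimately have \<rho>: "\<rho> > 0" "\<rho> \<le> \<delta>" by auto
    \<comment> \<open>The bound \<open>\<rho>/2\<close> keeps the disc inside, and
      \<open>1 / (16 * M)\<close> makes the two error terms together at most \<open>A / 2\<close>.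
      The two cases produce the summands 4 and \<open>256 * M\<^sup>2 * \<delta>\<^sup>2\<close> of
      the final constant.\<close>
    define t where "t = min (\<rho>/2) (1 / (16 * M))"
    have t: "t > 0" "t < \<rho>" "8 * M * t \<le> 1/2" using M \<rho> by (auto simp: t_def min_def field_simps)
    have bx: "x \<in> ball x1 \<delta> \<and> N x \<le> 4 * A" if "x \<in> cball x0 t" for x
    proof -
      have d: "dist x1 x \<le> \<delta> - \<rho>"
        using that t dist_triangle[of x1 x x0] \<rho>_def by (simp add: dist_commute field_simps)
      then have "\<rho>\<^sup>2 * N x \<le> H x" unfolding H_def
        by (intro mult_right_mono power_mono) (use \<rho> N0 in auto)
      also have "\<dots> \<le> 4 * \<rho>\<^sup>2 * A" using x0(2)[of x] d \<rho> H0 by simp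
      finally have "\<rho>\<^sup>2 * N x \<le> \<rho>\<^sup>2 * (4 * A)" by (simp add: mult_ac)
      then have "N x \<le> 4 * A" by (rule mult_left_le_imp_le) (use \<rho> in simp)
      then show ?thesis using d \<rho> by simp
    qed
    have tS: "cball x0 t \<subseteq> S" "ball x0 t \<subseteq> ball x1 \<delta>" using bx S by (force simp: subset_iff)+
    have comp: "cmod (h x0) \<le> 1 + 4 * M * A * t + C / (pi * t\<^sup>2)"
      if h: "has_partials S h h1 h2" and eqh: "\<And>x. x \<in> ball x1 \<delta> \<Longrightarrow> cmod (h1 x + \<i> * h2 x) \<le> M * N x"
        and hN: "\<And>x. cmod (h x) \<le> N x" for h h1 h2
    proof -
      have "ennreal (2*pi*(cmod (h x0) - 4*M*A*t - 1) * (pi * t\<^sup>2)) \<le> ennreal (2*pi) * (\<integral>\<^sup>+x\<in>ball x0 t. ennreal (N x ^ 4) \<partial>lborel)"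
      proof (rule solid_mean_lower)
        show "continuous_on (ball x0 t) (\<lambda>x. N x ^ 4)"
          by (intro continuous_intros continuous_on_subset[OF cN]) (use tS in force)
        fix z assume z: "z \<in> ball (0::complex) t"
        then have z': "z \<in> cball 0 t" by simp
        have K: "cmod (h1 x + \<i> * h2 x) \<le> 4*M*A" if "x \<in> cball x0 t" for x
        proof -
          have "cmod (h1 x + \<i> * h2 x) \<le> M * N x" using eqh bx[OF that] by auto
          also have "\<dots> \<le> M * (4*A)" using bx[OF that] M by (intro mult_left_mono) auto
          finally show ?thesis by (simp add: mult_ac)
        qed
        have "2 * pi * (cmod (h x0) - (4*M*A) * t) \<le> integral {0..2*pi} (\<lambda>\<theta>. cmod (h (x0 + z * cis \<theta>)))"
          by (rule dbar_mean[OF h tS(1) K z'])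
        \<comment> \<open>The inequality of s with \<open>1 + s ^ 4\<close> takes the place of
          Hoelder's inequality between the first and the fourth power.\<close>
        also have "\<dots> \<le> integral {0..2*pi} (\<lambda>\<theta>. 1 + N (x0 + z * cis \<theta>) ^ 4)"
        proof (rule integral_le)
          show "cmod (h y) \<le> 1 + N y ^ 4" for y
            using hN[of y] le_one_plus_power4[OF N0[of y]] by linarith
        qed (use continuous_on_circle_point[OF has_partials_continuous_on[OF h] tS(1) z'] continuous_on_circle_point[OF cN tS(1) z']
             in \<open>auto intro!: integrable_continuous_real continuous_intros\<close>)
        also have "\<dots> = 2 * pi + integral {0..2*pi} (\<lambda>\<theta>. N (x0 + z * cis \<theta>) ^ 4)"
          using continuous_on_circle_point[OF cN tS(1) z'] by (subst Henstock_Kurzweil_Integration.integral_add)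
            (auto intro!: integrable_continuous_real continuous_intros)
        finally show "2*pi*(cmod (h x0) - 4*M*A*t - 1) \<le> integral {0..2*pi} (\<lambda>\<theta>. N (x0 + z * cis \<theta>) ^ 4)"
          by (simp add: algebra_simps)
      qed (use t N0 in auto)
      also have "\<dots> \<le> ennreal (2*pi) * (\<integral>\<^sup>+x\<in>ball x1 \<delta>. ennreal (N x ^ 4) \<partial>lborel)"
        by (intro mult_left_mono nn_integral_mono) (use tS(2) in \<open>auto simp: indicator_def\<close>)
      also have "\<dots> \<le> ennreal (2*pi) * ennreal C" by (intro mult_left_mono energy) auto
      also have "\<dots> = ennreal (2*pi*C)" using C by (simp add: ennreal_mult)
      finally have "2*pi*(cmod (h x0) - 4*M*A*t - 1) * (pi * t\<^sup>2) \<le> 2*pi*C" using C by (simp add: ennreal_le_iff)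
      then have "2*pi*((cmod (h x0) - 4*M*A*t - 1) * (pi * t\<^sup>2)) \<le> 2*pi*C" by (simp only: mult.assoc)
      then have "(cmod (h x0) - 4*M*A*t - 1) * (pi * t\<^sup>2) \<le> C" by (rule mult_left_le_imp_le) simp
      then have "cmod (h x0) - 4*M*A*t - 1 \<le> C / (pi * t\<^sup>2)" using t by (simp add: pos_le_divide_eq)
      then show ?thesis by linarith
    qed
    \<comment> \<open>Conjugation exchanges the two Wirtinger derivatives, so the estimate for g
      also serves f.\<close>
    have hf: "cmod (f x0) \<le> 1 + 4 * M * A * t + C / (pi * t\<^sup>2)"
    proof -
      have "cmod (cnj (f x0)) \<le> 1 + 4 * M * A * t + C / (pi * t\<^sup>2)"
      proof (rule comp[OF has_partials_linear[OF f bounded_linear_cnj]])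
        fix x assume "x \<in> ball x1 \<delta>"
        moreover have "cnj (f1 x) + \<i> * cnj (f2 x) = cnj (f1 x - \<i> * f2 x)" by simp
        ultimately show "cmod (cnj (f1 x) + \<i> * cnj (f2 x)) \<le> M * N x"
          using eqf by (metis complex_mod_cnj)
      qed (auto simp: N_def norm_Pair real_sqrt_le_iff intro: real_le_rsqrt)
      then show ?thesis by simp
    qed
    have hg: "cmod (g x0) \<le> 1 + 4 * M * A * t + C / (pi * t\<^sup>2)"
      by (rule comp[OF g eqg]) (auto simp: N_def norm_Pair intro: real_le_rsqrt)
    have "A \<le> cmod (f x0) + cmod (g x0)" unfolding A_def N_def
      using norm_Pair_le by blast
    moreover have "(8 * M * t) * A = 2 * (4 * M * A * t)" by simp
    ultimately have "A \<le> 2 + (8 * M * t) * A + 2 * (C / (pi * t\<^sup>2))" using hf hg by linarith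
    moreover have "(8 * M * t) * A \<le> 1/2 * A" using t N0[of x0] by (intro mult_right_mono) (auto simp: A_def)
    ultimately have A: "A \<le> 4 + 4 * (C / (pi * t\<^sup>2))" by linarith
    have "H x0 \<le> 4 * \<rho>\<^sup>2 * (4 + 4 * (C / (pi * t\<^sup>2)))" unfolding H0 using A by (intro mult_left_mono) auto
    also have "\<dots> = 16 * \<rho>\<^sup>2 + 16 * C / pi * (\<rho>\<^sup>2 / t\<^sup>2)" by (simp add: algebra_simps)
    also have "\<dots> \<le> 16 * \<delta>\<^sup>2 + 16 * C / pi * (4 + 256 * M\<^sup>2 * \<delta>\<^sup>2)"
    proof (intro add_mono mult_left_mono)
      show "\<rho>\<^sup>2 \<le> \<delta>\<^sup>2" using \<rho> by (intro power_mono) auto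
      show "\<rho>\<^sup>2 / t\<^sup>2 \<le> 4 + 256 * M\<^sup>2 * \<delta>\<^sup>2"
      proof (cases "t = \<rho> / 2")
        case True
        then have "\<rho> = 2 * t" by simp
        then show ?thesis using t by (simp add: power_mult_distrib)
      next
        case False
        then have "t = 1 / (16 * M)" by (auto simp: t_def min_def split: if_splits)
        then have "\<rho>\<^sup>2 / t\<^sup>2 = 256 * M\<^sup>2 * \<rho>\<^sup>2" by (simp add: power_divide power_mult_distrib)
        also have "\<dots> \<le> 256 * M\<^sup>2 * \<delta>\<^sup>2" using \<rho> by (intro mult_left_mono power_mono) auto
        finally show ?thesis by simp
      qed
    qed (use C in auto)
    finally show ?thesis .
  qed
  then show ?thesis using x0(2)[OF x] by (simp add: H_def)
qed

subsection \<open>Blow-up sets of sequences\<close>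

text \<open>Let \<kappa> n be the greatest k up to n with \<open>P k n\<close>; every fixed k is
  eventually admissible, so \<kappa> is unbounded. The inserted 0 keeps the maximum defined and is
  harmless because \<open>P 0\<close> holds eventually. No index n is dropped, as
  \<open>Sigma1\<close> requires.\<close>

lemma diagonal_index:
  fixes P :: "nat \<Rightarrow> nat \<Rightarrow> bool"
  assumes "\<And>k. eventually (P k) sequentially"
  obtains \<kappa> :: "nat \<Rightarrow> nat" where "filterlim \<kappa> at_top sequentially" "eventually (\<lambda>n. P (\<kappa> n) n) sequentially"
proof
  define \<kappa> where "\<kappa> = (\<lambda>n. Max (insert 0 {k. k \<le> n \<and> P k n}))"
  have fin: "finite (insert 0 {k. k \<le> n \<and> P k n})" for n by simp
  show "filterlim \<kappa> at_top sequentially"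
    unfolding filterlim_at_top
  proof
    fix k
    show "\<forall>\<^sub>F n in sequentially. k \<le> \<kappa> n"
      using assms[of k] eventually_ge_at_top[of k]
    proof eventually_elim
      case (elim n)
      then show ?case unfolding \<kappa>_def by (intro Max_ge[OF fin]) simp
    qed
  qed
  show "eventually (\<lambda>n. P (\<kappa> n) n) sequentially"
    using assms[of 0]
  proof eventually_elim
    case (elim n)
    have "\<kappa> n \<in> insert 0 {k. k \<le> n \<and> P k n}" unfolding \<kappa>_def by (rule Max_in[OF fin]) simp
    then show ?case using elim by auto
  qed
qed

text \<open>Counterpart of \<open>diagonal_index\<close> for events that recur infinitely often; the
  price is passing to a subsequence.\<close>

lemma diagonal_subsequence:
  fixes P :: "nat \<Rightarrow> nat \<Rightarrow> bool"
  assumes "\<And>k. frequently (P k) sequentially"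
  obtains t :: "nat \<Rightarrow> nat" where "strict_mono t" "\<And>k. P k (t k)"
proof -
  have ex: "\<exists>n>N. P k n" for k N
    using assms[of k] unfolding frequently_sequentially by (metis Suc_le_lessD)
  have "\<exists>t. \<forall>k. P k (t k) \<and> t k < t (Suc k)"
    by (rule dependent_nat_choice) (use ex in blast)+
  then show ?thesis using that by (auto simp: strict_mono_Suc_iff)
qed

text \<open>A subsequence inherits the points \<open>y n\<close>. The inclusion can be strict, since
  extraction may select values that diverge only along some indices.\<close>

lemma Sigma1_subsequence:
  assumes "strict_mono t" shows "Sigma1 F r \<subseteq> Sigma1 (\<lambda>n. F (t n)) r"
proof
  fix x assume "x \<in> Sigma1 F r"
  then obtain y where y: "x \<in> ball 0 r" "\<And>n. y n \<in> ball 0 r" "y \<longlonglongrightarrow> x" "filterlim (\<lambda>n. F n (y n)) at_top sequentially"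
    by (auto simp: Sigma1_def)
  have t: "filterlim t at_top sequentially" using assms by (rule filterlim_subseq)
  have "(\<lambda>n. y (t n)) \<longlonglongrightarrow> x" "filterlim (\<lambda>n. F (t n) (y (t n))) at_top sequentially"
    using filterlim_compose[OF y(3) t] filterlim_compose[OF y(4) t] by auto
  then show "x \<in> Sigma1 (\<lambda>n. F (t n)) r" using y by (auto simp: Sigma1_def intro!: exI[of _ "\<lambda>n. y (t n)"])
qed

lemma Sigma1_witness:
  assumes x: "x \<in> ball 0 r" and \<kappa>: "filterlim \<kappa> at_top sequentially"
    and ev: "eventually (\<lambda>n. \<exists>y\<in>ball x (1 / real (Suc (\<kappa> n))). y \<in> ball 0 r \<and> F n y > real (\<kappa> n)) sequentially"
  shows "x \<in> Sigma1 F r"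
proof -
  \<comment> \<open>The default x keeps \<open>y n\<close> in the ball for the finitely many n that
    \<open>ev\<close> does not cover.\<close>
  define y where "y = (\<lambda>n. if \<exists>y\<in>ball x (1 / real (Suc (\<kappa> n))). y \<in> ball 0 r \<and> F n y > real (\<kappa> n)
     then SOME y. y\<in>ball x (1 / real (Suc (\<kappa> n))) \<and> y \<in> ball 0 r \<and> F n y > real (\<kappa> n) else x)"
  have y: "y n \<in> ball x (1 / real (Suc (\<kappa> n))) \<and> y n \<in> ball 0 r"
    "(\<exists>y\<in>ball x (1 / real (Suc (\<kappa> n))). y \<in> ball 0 r \<and> F n y > real (\<kappa> n)) \<Longrightarrow> F n (y n) > real (\<kappa> n)" for n
  proof -
    show "y n \<in> ball x (1 / real (Suc (\<kappa> n))) \<and> y n \<in> ball 0 r"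
    proof (cases "\<exists>y\<in>ball x (1 / real (Suc (\<kappa> n))). y \<in> ball 0 r \<and> F n y > real (\<kappa> n)")
      case True
      then show ?thesis unfolding y_def if_P[OF True] by (rule_tac someI2_ex) blast+
    next
      case False
      show ?thesis unfolding y_def if_not_P[OF False] using x by simp
    qed
    assume True: "\<exists>y\<in>ball x (1 / real (Suc (\<kappa> n))). y \<in> ball 0 r \<and> F n y > real (\<kappa> n)"
    then show "F n (y n) > real (\<kappa> n)" unfolding y_def if_P[OF True] by (rule_tac someI2_ex) blast+
  qed
  have "(\<lambda>k. 1 / real (Suc k)) \<longlonglongrightarrow> 0" using LIMSEQ_inverse_real_of_nat by (simp add: inverse_eq_divide)
  from filterlim_compose[OF this \<kappa>] have "(\<lambda>n. 1 / real (Suc (\<kappa> n))) \<longlonglongrightarrow> 0" .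
  moreover have "\<forall>\<^sub>F n in sequentially. norm (y n - x) \<le> 1 / real (Suc (\<kappa> n))"
    using y(1) by (intro always_eventually) (metis dist_norm dist_commute less_imp_le mem_ball)
  ultimately have "(\<lambda>n. y n - x) \<longlonglongrightarrow> 0" by (rule Lim_null_comparison[rotated])
  then have "y \<longlonglongrightarrow> x" by (simp add: LIM_zero_iff)
  moreover have "filterlim (\<lambda>n. F n (y n)) at_top sequentially"
  proof (rule filterlim_at_top_mono)
    show "filterlim (\<lambda>n. real (\<kappa> n)) at_top sequentially"
      using filterlim_compose[OF filterlim_real_sequentially \<kappa>] .
    show "\<forall>\<^sub>F n in sequentially. real (\<kappa> n) \<le> F n (y n)"
      using ev
    proof eventually_elim
      case (elim n)
      then show ?case using y(2)[of n] by linarith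
    qed
  qed
  ultimately show ?thesis using y(1) x by (auto simp: Sigma1_def)
qed

text \<open>If values above level k eventually occurred within distance \<open>1 / Suc k\<close> of
  x for every k, a diagonal choice would put x into \<open>Sigma1\<close>. The negation for one k
  bounds F for infinitely many n, not for all large n.\<close>

lemma not_Sigma1_frequently_bounded:
  assumes x: "x \<in> ball 0 r" "x \<notin> Sigma1 F r"
  obtains s M where "s > 0" "frequently (\<lambda>n. \<forall>y\<in>ball x s \<inter> ball 0 r. F n y \<le> M) sequentially"
proof (rule ccontr)
  assume neg: "\<not> thesis"
  define P where "P = (\<lambda>k n. \<exists>y\<in>ball x (1 / real (Suc k)). y \<in> ball 0 r \<and> F n y > real k)"
  have "eventually (P k) sequentially" for k
  proof -
    have "\<not> frequently (\<lambda>n. \<forall>y\<in>ball x (1 / real (Suc k)) \<inter> ball 0 r. F n y \<le> real k) sequentially"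
      using that[of "1 / real (Suc k)" "real k"] neg by fastforce
    then show ?thesis unfolding P_def not_frequently by (rule eventually_mono) (auto simp: not_le)
  qed
  then obtain \<kappa> where "filterlim \<kappa> at_top sequentially" "eventually (\<lambda>n. P (\<kappa> n) n) sequentially"
    using diagonal_index[of P] by blast
  then have "x \<in> Sigma1 F r" unfolding P_def by (rule Sigma1_witness[OF x(1)])
  then show False using x by simp
qed

definition locally_bdd_above :: "(nat \<Rightarrow> complex \<Rightarrow> real) \<Rightarrow> complex \<Rightarrow> bool" where
  "locally_bdd_above F x \<longleftrightarrow> (\<exists>s>0. \<exists>M. eventually (\<lambda>n. \<forall>y\<in>ball x s. F n y \<le> M) sequentially)"

text \<open>Without a local bound, values above every level recur near x; the recurring indices form
  a subsequence for which x is a blow-up point.\<close>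

lemma Sigma1_new_point:
  assumes x: "x \<in> ball 0 r" "\<not> locally_bdd_above F x"
  obtains t where "strict_mono t" "x \<in> Sigma1 (\<lambda>n. F (t n)) r"
proof -
  obtain d where d: "d > 0" "ball x d \<subseteq> ball 0 r" using x(1) open_ball open_contains_ball by blast
  define P where "P = (\<lambda>k n. \<exists>y\<in>ball x (1 / real (Suc k)). y \<in> ball 0 r \<and> F n y > real k)"
  have "frequently (P k) sequentially" for k
  proof (rule ccontr)
    assume "\<not> frequently (P k) sequentially"
    then have "eventually (\<lambda>n. \<forall>y\<in>ball x (min d (1 / real (Suc k))). F n y \<le> real k) sequentially"
      unfolding not_frequently
    proof (rule eventually_mono)
      fix n assume n: "\<not> P k n"
      show "\<forall>y\<in>ball x (min d (1 / real (Suc k))). F n y \<le> real k"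
      proof
        fix y assume y: "y \<in> ball x (min d (1 / real (Suc k)))"
        then have "y \<in> ball 0 r" "y \<in> ball x (1 / real (Suc k))" using d(2) by auto
        then show "F n y \<le> real k" using n unfolding P_def by (meson not_le)
      qed
    qed
    then show False using x(2) d unfolding locally_bdd_above_def
      by (auto dest!: spec[of _ "min d (1 / real (Suc k))"])
  qed
  then obtain t where t: "strict_mono t" "\<And>k. P k (t k)" using diagonal_subsequence[of P] by blast
  have "x \<in> Sigma1 (\<lambda>n. F (t n)) r"
    by (rule Sigma1_witness[OF x(1) filterlim_ident]) (use t(2) in \<open>auto simp: P_def\<close>)
  then show ?thesis using t(1) that by blast
qed

text \<open>A finite subcover and the largest of its constants. The predicate is abstract so as to
  serve upper bounds as well as divergence to minus infinity.\<close>

lemma compact_eventually_uniform: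
  fixes Q :: "real \<Rightarrow> nat \<Rightarrow> complex \<Rightarrow> bool"
  assumes K: "compact K" and Q: "\<And>x. x \<in> K \<Longrightarrow> \<exists>s>0. \<exists>M. eventually (\<lambda>n. \<forall>y\<in>ball x s. Q M n y) sequentially"
    and mono: "\<And>M M' n y. Q M n y \<Longrightarrow> M \<le> M' \<Longrightarrow> Q M' n y"
  shows "\<exists>M. eventually (\<lambda>n. \<forall>y\<in>K. Q M n y) sequentially"
proof -
  obtain s M where sM: "\<And>x. x \<in> K \<Longrightarrow> s x > 0 \<and> eventually (\<lambda>n. \<forall>y\<in>ball x (s x). Q (M x) n y) sequentially"
    using Q by metis
  obtain T where T: "T \<subseteq> K" "finite T" "K \<subseteq> (\<Union>x\<in>T. ball x (s x))"
    by (rule compactE_image[OF K, of K "\<lambda>x. ball x (s x)"]) (use sM in auto)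
  obtain B where B: "\<And>x. x \<in> T \<Longrightarrow> M x \<le> B"
  proof
    show "M x \<le> Max (M ` T)" if "x \<in> T" for x using T(2) that by (intro Max_ge) auto
  qed
  have "eventually (\<lambda>n. \<forall>x\<in>T. \<forall>y\<in>ball x (s x). Q (M x) n y) sequentially"
    using T sM by (intro eventually_ball_finite) auto
  then have "eventually (\<lambda>n. \<forall>y\<in>K. Q B n y) sequentially"
    by (rule eventually_mono) (use T(3) B mono in blast)
  then show ?thesis by blast
qed

text \<open>\<open>bounded_loc\<close> speaks of all n: covering handles the large ones, and
  continuity on a compact set the finitely many others.\<close>

lemma locally_bdd_above_compact:
  assumes K: "compact K" "K \<subseteq> S" and cont: "\<And>n. continuous_on S (F n)"
    and bdd: "\<And>x. x \<in> K \<Longrightarrow> locally_bdd_above F x"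
  shows "\<exists>M. \<forall>n. \<forall>x\<in>K. F n x \<le> M"
proof -
  have "\<exists>M. eventually (\<lambda>n. \<forall>y\<in>K. F n y \<le> M) sequentially"
    by (rule compact_eventually_uniform[OF K(1)]) (use bdd in \<open>auto simp: locally_bdd_above_def\<close>)
  then obtain M N where MN: "\<And>n y. n \<ge> N \<Longrightarrow> y \<in> K \<Longrightarrow> F n y \<le> M"
    by (auto simp: eventually_sequentially)
  have "\<exists>B. \<forall>x\<in>K. F n x \<le> B" for n
  proof -
    have "compact (F n ` K)" using K cont compact_continuous_image continuous_on_subset by blast
    then have "bdd_above (F n ` K)" by (intro bounded_imp_bdd_above compact_imp_bounded)
    then show ?thesis by (auto simp: bdd_above_def)
  qed
  then obtain B where B: "\<And>n x. x \<in> K \<Longrightarrow> F n x \<le> B n" by metis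
  obtain B' where B': "\<And>n. n < N \<Longrightarrow> B n \<le> B'"
  proof
    show "B n \<le> Max (B ` {..<N})" if "n < N" for n using that by (intro Max_ge) auto
  qed
  have "F n x \<le> max M B'" if "x \<in> K" for n x
    using MN[of n x] B[OF that, of n] B'[of n] that by (cases "n < N") (auto simp: max_def)
  then show ?thesis by blast
qed

subsection \<open>Solutions of the system\<close>

lemma has_partials_eq:
  assumes "has_partials S f f1 f2" "x \<in> S"
  shows "px f x = f1 x" "py f x = f2 x"
  using has_derivative_imp_px[OF has_partials_D[OF assms]] by simp_all

section \<open>The regularised weight\<close>

text \<open>\<open>2 * ln (cmod x)\<close> is harmonic off the origin and has a point mass there;
  adding \<open>\<eta>\<^sup>2\<close> smears this mass out into an explicit positive
  density.\<close>

lemma has_laplacian_log: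
  assumes \<eta>: "\<eta> > 0"
  shows "has_laplacian S (\<lambda>x. ln ((cmod x)\<^sup>2 + \<eta>\<^sup>2)) (\<lambda>x. 4 * \<eta>\<^sup>2 / ((cmod x)\<^sup>2 + \<eta>\<^sup>2)\<^sup>2)"
proof -
  define D where "D = (\<lambda>x. (Re x)\<^sup>2 + (Im x)\<^sup>2 + \<eta>\<^sup>2)"
  have D: "D x > 0" "D x \<noteq> 0" for x
    using \<eta> by (auto simp: D_def add_nonneg_pos less_imp_neq[symmetric])
  have dD: "(D has_derivative (\<lambda>h. 2 * Re x * Re h + 2 * Im x * Im h)) (at x)" for x
    unfolding D_def by (auto intro!: derivative_eq_intros)
  have cD [continuous_intros]: "continuous_on S D" unfolding D_def by (intro continuous_intros)
  have 1: "has_partials S (\<lambda>x. ln (D x)) (\<lambda>x. 2 * Re x / D x) (\<lambda>x. 2 * Im x / D x)"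
    unfolding has_partials_def
    by (auto intro!: derivative_eq_intros dD continuous_intros simp: D field_simps)
  have 2: "has_partials S (\<lambda>x. 2 * Re x / D x) (\<lambda>x. 2 / D x - 4 * (Re x)\<^sup>2 / (D x)\<^sup>2) (\<lambda>x. - 4 * Re x * Im x / (D x)\<^sup>2)"
    unfolding has_partials_def
    by (auto intro!: derivative_eq_intros dD continuous_intros simp: D field_simps power2_eq_square)
  have 3: "has_partials S (\<lambda>x. 2 * Im x / D x) (\<lambda>x. - 4 * Re x * Im x / (D x)\<^sup>2) (\<lambda>x. 2 / D x - 4 * (Im x)\<^sup>2 / (D x)\<^sup>2)"
    unfolding has_partials_def
    by (auto intro!: derivative_eq_intros dD continuous_intros simp: D field_simps power2_eq_square)
  have Deq: "(cmod x)\<^sup>2 + \<eta>\<^sup>2 = D x" for x by (simp add: D_def cmod_power2)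
  have "4 * \<eta>\<^sup>2 / (D x)\<^sup>2 = 2 / D x - 4 * (Re x)\<^sup>2 / (D x)\<^sup>2 + (2 / D x - 4 * (Im x)\<^sup>2 / (D x)\<^sup>2)" for x
  proof -
    have "2 / D x = 2 * D x / (D x)\<^sup>2" using D[of x] by (simp add: power2_eq_square)
    then have "2 / D x - 4 * (Re x)\<^sup>2 / (D x)\<^sup>2 + (2 / D x - 4 * (Im x)\<^sup>2 / (D x)\<^sup>2)
       = (4 * D x - 4 * (Re x)\<^sup>2 - 4 * (Im x)\<^sup>2) / (D x)\<^sup>2" by (simp add: diff_divide_distrib add_divide_distrib)
    then show ?thesis by (simp add: D_def)
  qed
  then show ?thesis unfolding Deq by (intro has_laplacianI[OF 1 2 3]) auto
qed

lemma weight_exp: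
  assumes "\<eta> > 0"
  shows "exp (2 * (v + \<alpha> / 2 * ln ((cmod x)\<^sup>2 + \<eta>\<^sup>2))) = ((cmod x)\<^sup>2 + \<eta>\<^sup>2) powr \<alpha> * exp (2 * v)"
proof -
  have "(cmod x)\<^sup>2 + \<eta>\<^sup>2 > 0" using assms by (simp add: add_nonneg_pos)
  then show ?thesis using assms by (simp add: powr_def exp_add algebra_simps)
qed

lemma weight_square:
  "(x\<^sup>2 + 0\<^sup>2) powr \<alpha> = x powr (2 * \<alpha>)" if "x \<ge> 0" for x :: real
  using that by (cases "x = 0") (simp_all add: powr_powr[symmetric])

lemma weight_le:
  "(cmod x) powr (2 * \<alpha>) \<le> ((cmod x)\<^sup>2 + \<eta>\<^sup>2) powr \<alpha>" if "\<alpha> > 0"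
  using weight_square[of "cmod x" \<alpha>] that powr_mono2[of \<alpha> "(cmod x)\<^sup>2" "(cmod x)\<^sup>2 + \<eta>\<^sup>2"] by simp

text \<open>The weight \<open>|x|\<close> is replaced by the square root of \<open>|x|\<^sup>2 + \<eta>\<^sup>2\<close>: the logarithm of the new density is
  \<open>C\<^sup>2\<close> across the origin and its Laplacian only becomes larger.\<close>
lemma weighted_eps_regularity:
  assumes u: "has_laplacian S u l" and S: "cball x1 d \<subseteq> S" and d: "d > 0" and k: "k > 0" and \<alpha>: "\<alpha> > 0"
    and l: "\<And>x. x \<in> cball x1 d \<Longrightarrow> l x \<ge> - k * (cmod x powr (2 * \<alpha>) * exp (2 * u x))"
    and mass: "(\<integral>\<^sup>+x\<in>ball x1 d. ennreal (cmod x powr (2 * \<alpha>) * exp (2 * u x)) \<partial>lborel) < ennreal \<epsilon>"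
    and \<epsilon>: "\<epsilon> > 0" "2 * k * \<epsilon> < pi * exp (-2)" and x: "x \<in> cball x1 d"
  shows "(d - dist x1 x)\<^sup>2 * (cmod x powr (2 * \<alpha>) * exp (2 * u x)) \<le> 4 / k"
proof -
  define h where "h = (\<lambda>(\<eta>::real, x). ((cmod x)\<^sup>2 + \<eta>\<^sup>2) powr \<alpha> * exp (2 * u x))"
  \<comment> \<open>An error \<kappa> integrates over the disc to \<epsilon>, so the regularised
    mass is at most \<open>2 * \<epsilon>\<close>; this is the factor 2 in the smallness
    hypothesis.\<close>
  define \<kappa> where "\<kappa> = \<epsilon> / (pi * d\<^sup>2)"
  have \<kappa>: "\<kappa> > 0" using \<epsilon> d by (simp add: \<kappa>_def)
  have cu: "continuous_on (cball x1 d) u" using has_laplacian_continuous[OF u] S continuous_on_subset by blast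
  \<comment> \<open>Uniform continuity on the compact product, including \<eta> = 0, provides one
    positive \<eta> whose error is below \<kappa> at every x.\<close>
  have "continuous_on ({0..1} \<times> cball x1 d) h" unfolding h_def case_prod_beta'
    using \<alpha> by (intro continuous_intros continuous_on_powr' continuous_on_compose2[OF cu]) auto
  then have "uniformly_continuous_on ({0..1} \<times> cball x1 d) h"
    by (rule compact_uniformly_continuous) (intro compact_Times compact_Icc compact_cball)
  then obtain e where e: "e > 0" "\<And>p q. p \<in> {0..1} \<times> cball x1 d \<Longrightarrow> q \<in> {0..1} \<times> cball x1 d \<Longrightarrow> dist q p < e \<Longrightarrow> dist (h q) (h p) < \<kappa>"
    unfolding uniformly_continuous_on_def using \<kappa> by meson
  define \<eta> where "\<eta> = min 1 (e / 2)"
  have \<eta>: "\<eta> > 0" "\<eta> \<le> 1" "\<eta> < e" using e(1) by (auto simp: \<eta>_def)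
  define w where "w = (\<lambda>x. u x + \<alpha> / 2 * ln ((cmod x)\<^sup>2 + \<eta>\<^sup>2))"
  have wexp: "exp (2 * w x) = ((cmod x)\<^sup>2 + \<eta>\<^sup>2) powr \<alpha> * exp (2 * u x)" for x
    unfolding w_def by (rule weight_exp[OF \<eta>(1)])
  have vle: "cmod x powr (2 * \<alpha>) * exp (2 * u x) \<le> exp (2 * w x)" for x
    unfolding wexp by (intro mult_right_mono weight_le \<alpha>) auto
  have wle: "exp (2 * w x) \<le> cmod x powr (2 * \<alpha>) * exp (2 * u x) + \<kappa>" if "x \<in> cball x1 d" for x
  proof -
    have "dist (h (\<eta>, x)) (h (0, x)) < \<kappa>" by (rule e(2)) (use that \<eta> in \<open>auto simp: dist_Pair_Pair\<close>)
    then show ?thesis unfolding wexp h_def by (simp add: dist_real_def weight_square[simplified])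
  qed
  have has_laplacian_w: "has_laplacian S w (\<lambda>x. l x + \<alpha> / 2 * (4 * \<eta>\<^sup>2 / ((cmod x)\<^sup>2 + \<eta>\<^sup>2)\<^sup>2))"
    unfolding w_def by (intro has_laplacian_add u has_laplacian_cmult has_laplacian_log \<eta>)
  have "(d - dist x1 x)\<^sup>2 * exp (2 * w x) \<le> 4 / k"
  proof (rule eps_regularity[OF has_laplacian_w S d k _ _ _ _ x, where \<epsilon>="2*\<epsilon>"])
    fix y assume y: "y \<in> cball x1 d"
    have "- k * exp (2 * w y) \<le> - k * (cmod y powr (2 * \<alpha>) * exp (2 * u y))"
      using mult_left_mono[OF vle[of y], of k] k by simp
    also have "\<dots> \<le> l y" by (rule l[OF y])
    also have "\<dots> \<le> l y + \<alpha> / 2 * (4 * \<eta>\<^sup>2 / ((cmod y)\<^sup>2 + \<eta>\<^sup>2)\<^sup>2)" using \<alpha> by simp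
    finally show "- k * exp (2 * w y) \<le> l y + \<alpha> / 2 * (4 * \<eta>\<^sup>2 / ((cmod y)\<^sup>2 + \<eta>\<^sup>2)\<^sup>2)" .
  next
    define g where "g = (\<lambda>x. cmod x powr (2 * \<alpha>) * exp (2 * u x))"
    have cg: "continuous_on (ball x1 d) g" unfolding g_def
      using \<alpha> by (intro continuous_intros continuous_on_powr' continuous_on_subset[OF cu]) auto
    have "(\<lambda>x. indicator (ball x1 d) x *\<^sub>R g x) \<in> borel_measurable borel"
      using cg by (intro borel_measurable_continuous_on_indicator) auto
    then have "(\<lambda>x. ennreal (indicator (ball x1 d) x *\<^sub>R g x)) \<in> borel_measurable borel" by measurable
    also have "(\<lambda>x. ennreal (indicator (ball x1 d) x *\<^sub>R g x)) = (\<lambda>x. ennreal (g x) * indicator (ball x1 d) x)"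
      by (auto simp: indicator_def)
    finally have [measurable]: "(\<lambda>x. ennreal (g x) * indicator (ball x1 d) x) \<in> borel_measurable borel" .
    have "(\<integral>\<^sup>+x\<in>ball x1 d. ennreal (exp (2 * w x)) \<partial>lborel)
        \<le> (\<integral>\<^sup>+x. ennreal (g x) * indicator (ball x1 d) x + ennreal \<kappa> * indicator (ball x1 d) x \<partial>lborel)"
      using wle \<kappa> by (intro nn_integral_mono) (auto simp: indicator_def g_def simp flip: ennreal_plus)
    also have "\<dots> = (\<integral>\<^sup>+x\<in>ball x1 d. ennreal (g x) \<partial>lborel) + (\<integral>\<^sup>+x\<in>ball x1 d. ennreal \<kappa> \<partial>lborel)"
    proof (rule nn_integral_add)
      show "(\<lambda>x. ennreal \<kappa> * indicator (ball x1 d) x) \<in> borel_measurable lborel"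
        by (intro borel_measurable_times_ennreal borel_measurable_indicator) auto
    qed simp
    also have "(\<integral>\<^sup>+x\<in>ball x1 d. ennreal \<kappa> \<partial>lborel) = ennreal \<epsilon>"
      using d \<kappa> by (simp add: nn_integral_cmult_indicator emeasure_disc \<kappa>_def flip: ennreal_mult')
    also have "(\<integral>\<^sup>+x\<in>ball x1 d. ennreal (g x) \<partial>lborel) + ennreal \<epsilon> \<le> ennreal \<epsilon> + ennreal \<epsilon>"
      using mass by (intro add_right_mono) (simp add: g_def less_imp_le)
    also have "\<dots> = ennreal (2 * \<epsilon>)" using \<epsilon> by (simp flip: ennreal_plus)
    finally show "(\<integral>\<^sup>+x\<in>ball x1 d. ennreal (exp (2 * w x)) \<partial>lborel) \<le> ennreal (2 * \<epsilon>)" .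
  qed (use \<epsilon> in \<open>auto simp: mult_ac\<close>)
  moreover have "(d - dist x1 x)\<^sup>2 * (cmod x powr (2 * \<alpha>) * exp (2 * u x)) \<le> (d - dist x1 x)\<^sup>2 * exp (2 * w x)"
    by (intro mult_left_mono vle) auto
  ultimately show ?thesis by linarith
qed

text \<open>Since c is at most 1, its powers decrease in the exponent, and the common bound A of the
  exponents makes the result independent of \<alpha>.\<close>

lemma bound_from_weight:
  assumes B: "cmod y powr (2 * \<alpha>) * exp (2 * v) \<le> B" and c: "0 < c" "c \<le> 1" "c \<le> cmod y" and \<alpha>: "0 < \<alpha>" "\<alpha> \<le> A"
  shows "v \<le> ln (B / c powr (2 * A)) / 2"
proof -
  have "c powr (2 * A) \<le> c powr (2 * \<alpha>)" using c \<alpha> by (intro powr_mono') auto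
  also have "\<dots> \<le> cmod y powr (2 * \<alpha>)" using c \<alpha> by (intro powr_mono2) auto
  finally have "c powr (2 * A) * exp (2 * v) \<le> B"
    using B by (meson exp_ge_zero mult_right_mono order_trans)
  then have "exp (2 * v) \<le> B / c powr (2 * A)" using c by (simp add: pos_le_divide_eq mult.commute)
  then have "2 * v \<le> ln (B / c powr (2 * A))"
    by (metis exp_gt_zero less_le_trans ln_exp ln_le_cancel_iff)
  then show ?thesis by simp
qed

section \<open>Concentration of mass at blow-up points\<close>

text \<open>The convergence of the exponents is recorded as the bound A. Every assumption concerns
  single indices and thus passes to subsequences, for which the locale is interpreted anew.\<close>

locale liouville_dirac =
  fixes u :: "nat \<Rightarrow> complex \<Rightarrow> real"
    and \<Psi> :: "nat \<Rightarrow> complex \<Rightarrow> complex \<times> complex"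
    and V :: "complex \<Rightarrow> real"
    and \<alpha>s :: "nat \<Rightarrow> real" and A r C a b :: real
  assumes r: "r > 0"
    and reg_u: "\<And>n. C2_on (ball 0 r) (u n)"
    and reg_\<Psi>: "\<And>n. C1_on (ball 0 r) (\<Psi> n)"
    and eq_u: "\<And>n x. x \<in> ball 0 r \<Longrightarrow>
        - laplacian (u n) x = 2 * (V x)\<^sup>2 * cmod x powr (2 * \<alpha>s n) * exp (2 * u n x)
                               - V x * cmod x powr (\<alpha>s n) * exp (u n x) * (norm (\<Psi> n x))\<^sup>2"
    and eq_\<Psi>: "\<And>n x. x \<in> ball 0 r \<Longrightarrow>
        dirac (\<Psi> n) x = (- (V x * cmod x powr (\<alpha>s n) * exp (u n x))) *\<^sub>R \<Psi> n x"
    and C: "C > 0"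
    and energy_u: "\<And>n. set_nn_integral lborel (ball 0 r)
                      (\<lambda>x. ennreal (cmod x powr (2 * \<alpha>s n) * exp (2 * u n x))) < ennreal C"
    and energy_\<Psi>: "\<And>n. set_nn_integral lborel (ball 0 r)
                      (\<lambda>x. ennreal ((norm (\<Psi> n x)) ^ 4)) < ennreal C"
    and alpha: "\<And>n. 0 < \<alpha>s n" "\<And>n. \<alpha>s n \<le> A"
    and V_bounds: "0 < a" "\<And>x. x \<in> ball 0 r \<Longrightarrow> a \<le> V x \<and> V x \<le> b"
begin

lemma subsequence: "liouville_dirac (\<lambda>n. u (t n)) (\<lambda>n. \<Psi> (t n)) V (\<lambda>n. \<alpha>s (t n)) A r C a b"
  by unfold_locales (use r reg_u reg_\<Psi> eq_u eq_\<Psi> C energy_u energy_\<Psi> alpha V_bounds in blast)+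

lemma b_pos: "b > 0"
  using V_bounds(1) V_bounds(2)[of 0] r by auto

lemma has_laplacian_u: "has_laplacian (ball 0 r) (u n) (laplacian (u n))"
  using reg_u by (rule C2_on_has_laplacian)

lemma continuous_u: "continuous_on (ball 0 r) (u n)"
  using has_laplacian_u by (rule has_laplacian_continuous)

lemma continuous_\<Psi>: "continuous_on (ball 0 r) (\<Psi> n)"
  using C1_on_has_partials[OF reg_\<Psi>] by (rule has_partials_continuous_on)

lemma laplacian_lower:
  assumes x: "x \<in> ball 0 r"
  shows "laplacian (u n) x \<ge> - (2 * b\<^sup>2) * (cmod x powr (2 * \<alpha>s n) * exp (2 * u n x))"
proof -
  have V: "0 \<le> V x" "V x \<le> b" using V_bounds x by force+
  have "(V x)\<^sup>2 * (cmod x powr (2 * \<alpha>s n) * exp (2 * u n x)) \<le> b\<^sup>2 * (cmod x powr (2 * \<alpha>s n) * exp (2 * u n x))"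
    using V by (intro mult_right_mono power_mono) auto
  moreover have "0 \<le> V x * cmod x powr (\<alpha>s n) * exp (u n x) * (norm (\<Psi> n x))\<^sup>2" using V by simp
  moreover have "- laplacian (u n) x = 2 * ((V x)\<^sup>2 * (cmod x powr (2 * \<alpha>s n) * exp (2 * u n x)))
      - V x * cmod x powr (\<alpha>s n) * exp (u n x) * (norm (\<Psi> n x))\<^sup>2"
    using eq_u[OF x, of n] by (simp add: mult.assoc)
  ultimately show ?thesis by linarith
qed

text \<open>Half of \<open>pi * exp (-2) / (2 * k)\<close>, the threshold of
  \<open>weighted_eps_regularity\<close>, for the constant \<open>k = 2 * b\<^sup>2\<close> of
  \<open>laplacian_lower\<close>.\<close>

definition \<epsilon>0 :: real where "\<epsilon>0 = pi * exp (-2) / (8 * b\<^sup>2)"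

lemma \<epsilon>0: "\<epsilon>0 > 0" "2 * (2 * b\<^sup>2) * \<epsilon>0 < pi * exp (-2)"
  using b_pos by (auto simp: \<epsilon>0_def field_simps)

lemma small_mass_bounded:
  assumes d: "d > 0" "cball x1 d \<subseteq> ball 0 r"
  obtains s M where "s > 0" "\<And>n y. (\<integral>\<^sup>+x\<in>ball x1 d. ennreal (cmod x powr (2 * \<alpha>s n) * exp (2 * u n x)) \<partial>lborel) < ennreal \<epsilon>0
      \<Longrightarrow> y \<in> ball x1 s \<Longrightarrow> u n y \<le> M"
proof -
  \<comment> \<open>The bound \<open>4 / (2 * b\<^sup>2)\<close> for the weighted density is divided
    by \<open>(d/2)\<^sup>2\<close>, because points of the half disc are at least \<open>d/2\<close>
    away from the boundary.\<close>
  define B where "B = 8 / (b\<^sup>2 * d\<^sup>2)"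
  have small: "cmod y powr (2 * \<alpha>s n) * exp (2 * u n y) \<le> B"
    if m: "(\<integral>\<^sup>+x\<in>ball x1 d. ennreal (cmod x powr (2 * \<alpha>s n) * exp (2 * u n x)) \<partial>lborel) < ennreal \<epsilon>0"
      and y: "y \<in> cball x1 (d/2)" for n y
  proof -
    define v where "v = cmod y powr (2 * \<alpha>s n) * exp (2 * u n y)"
    have "(d - dist x1 y)\<^sup>2 * v \<le> 4 / (2 * b\<^sup>2)" unfolding v_def
      by (rule weighted_eps_regularity[OF has_laplacian_u d(2,1) _ alpha(1) laplacian_lower m \<epsilon>0]) (use b_pos d y in auto)
    moreover have "(d/2)\<^sup>2 * v \<le> (d - dist x1 y)\<^sup>2 * v"
      using y d by (intro mult_right_mono power_mono) (auto simp: v_def)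
    ultimately have "(d/2)\<^sup>2 * v \<le> 4 / (2 * b\<^sup>2)" by linarith
    then show ?thesis unfolding v_def[symmetric] B_def using d b_pos by (simp add: field_simps)
  qed
  show ?thesis
  proof (cases "x1 = 0")
    case False
    define s where "s = min (d/2) (cmod x1 / 2)"
    define c where "c = min 1 (cmod x1 / 2)"
    show ?thesis
    proof (rule that)
      show "s > 0" using d False by (simp add: s_def)
      fix n y assume m: "(\<integral>\<^sup>+x\<in>ball x1 d. ennreal (cmod x powr (2 * \<alpha>s n) * exp (2 * u n x)) \<partial>lborel) < ennreal \<epsilon>0"
        and y: "y \<in> ball x1 s"
      have "c \<le> cmod y" using y norm_triangle_ineq2[of x1 y] by (auto simp: s_def c_def dist_norm)
      moreover have "y \<in> cball x1 (d/2)" using y by (auto simp: s_def)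
      ultimately show "u n y \<le> ln (B / c powr (2 * A)) / 2"
        using bound_from_weight[OF small[OF m], of y c A] alpha False by (auto simp: c_def)
    qed
  next
    case True
    text \<open>The weight degenerates at the centre, so \<open>u\<close> is bounded there by its means over circles away from \<open>0\<close>.\<close>
    define s where "s = d / 8"
    define c where "c = min 1 s"
    define M where "M = ln (B / c powr (2 * A)) / 2"
    show ?thesis
    proof (rule that)
      show s: "s > 0" using d by (simp add: s_def)
      fix n y assume m: "(\<integral>\<^sup>+x\<in>ball x1 d. ennreal (cmod x powr (2 * \<alpha>s n) * exp (2 * u n x)) \<partial>lborel) < ennreal \<epsilon>0"
        and y: "y \<in> ball x1 s"
      have y0: "cmod y < s" using y True by simp
      have sub: "cball y (2 * s) \<subseteq> cball 0 (d/2)"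
      proof
        fix x assume "x \<in> cball y (2 * s)"
        then show "x \<in> cball 0 (d/2)" using y0 dist_triangle[of 0 x y] d by (simp add: s_def)
      qed
      have sub': "cball (0::complex) (d/2) \<subseteq> ball 0 r" using subset_trans[OF subset_cball[of "d/2" d 0] d(2)[unfolded True]] d(1) by simp
      \<comment> \<open>As \<open>cmod y < s\<close>, the circle of radius \<open>2 * s\<close>
        about y stays outside the disc of radius s about 0, where the weight is small, and within
        distance \<open>3 * s\<close> of 0, which is below \<open>d/2\<close>.\<close>
      have "2 * pi * (u n y - (2 * b\<^sup>2 * B) * (cmod (of_real (2 * s)))\<^sup>2 / 4) \<le> integral {0..2*pi} (\<lambda>\<theta>. u n (y + of_real (2 * s) * cis \<theta>))"
      proof (rule laplacian_mean_lower[OF has_laplacian_u, where t="2 * s"])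
        show "cball y (2 * s) \<subseteq> ball 0 r" using sub sub' by blast
        fix x assume "x \<in> cball y (2 * s)"
        then have x: "x \<in> cball 0 (d/2)" using sub by blast
        have "b\<^sup>2 * (cmod x powr (2 * \<alpha>s n) * exp (2 * u n x)) \<le> b\<^sup>2 * B"
          using small[OF m, of x] x True by (intro mult_left_mono) auto
        then show "- (2 * b\<^sup>2 * B) \<le> laplacian (u n) x" using laplacian_lower[of x n] x sub' by force
      qed (use s in auto)
      also have "\<dots> \<le> integral {0..2*pi} (\<lambda>\<theta>. M)"
      proof (rule integral_le)
        have zS: "y + of_real (2 * s) * cis \<theta> \<in> cball y (2 * s)" for \<theta>
          using s by (simp add: dist_norm norm_mult)
        then show "(\<lambda>\<theta>. u n (y + of_real (2 * s) * cis \<theta>)) integrable_on {0..2*pi}"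
          by (intro integrable_continuous_real continuous_on_compose2[OF continuous_u] continuous_intros) (use sub sub' in blast)
        fix \<theta>
        have "c \<le> cmod (y + of_real (2 * s) * cis \<theta>)"
          using y0 s norm_triangle_ineq2[of "of_real (2 * s) * cis \<theta>" "- y"] by (simp add: norm_mult c_def add.commute)
        then show "u n (y + of_real (2 * s) * cis \<theta>) \<le> M" unfolding M_def
          using bound_from_weight[OF small[OF m], of "y + of_real (2 * s) * cis \<theta>" c A] alpha s sub zS[of \<theta>] True
          by (auto simp: c_def)
      qed auto
      finally have "2 * pi * (u n y - (2 * b\<^sup>2 * B) * (2 * s)\<^sup>2 / 4) \<le> 2 * pi * M" using s by simp
      then have "u n y - (2 * b\<^sup>2 * B) * (2 * s)\<^sup>2 / 4 \<le> M" by (rule mult_left_le_imp_le) simp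
      then show "u n y \<le> M + (2 * b\<^sup>2 * B) * (2 * s)\<^sup>2 / 4" by linarith
    qed
  qed
qed

text \<open>Small mass for infinitely many n is enough: for those n the values near x are at most M,
  while blow-up would exceed M for all large n.\<close>

lemma frequently_small_mass_not_Sigma1:
  assumes d: "d > 0" "cball x d \<subseteq> ball 0 r"
    and freq: "frequently (\<lambda>n. (\<integral>\<^sup>+x\<in>ball x d. ennreal (cmod x powr (2 * \<alpha>s n) * exp (2 * u n x)) \<partial>lborel) < ennreal \<epsilon>0) sequentially"
  shows "x \<notin> Sigma1 u r"
proof
  assume "x \<in> Sigma1 u r"
  then obtain y where y: "y \<longlonglongrightarrow> x" "filterlim (\<lambda>n. u n (y n)) at_top sequentially" by (auto simp: Sigma1_def)
  obtain s M where s: "s > 0" and sM: "\<And>n y. (\<integral>\<^sup>+x\<in>ball x d. ennreal (cmod x powr (2 * \<alpha>s n) * exp (2 * u n x)) \<partial>lborel) < ennreal \<epsilon>0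
      \<Longrightarrow> y \<in> ball x s \<Longrightarrow> u n y \<le> M"
    by (rule small_mass_bounded[OF d]) (rule that)
  have "eventually (\<lambda>n. dist (y n) x < s) sequentially" using y(1) s by (rule tendstoD)
  moreover have "eventually (\<lambda>n. u n (y n) > M) sequentially"
    using y(2) by (simp add: filterlim_at_top_dense)
  ultimately have "eventually (\<lambda>n. \<not> (\<integral>\<^sup>+x\<in>ball x d. ennreal (cmod x powr (2 * \<alpha>s n) * exp (2 * u n x)) \<partial>lborel) < ennreal \<epsilon>0) sequentially"
  proof eventually_elim
    case (elim n)
    then show ?case using sM[of n "y n"] by (auto simp: dist_commute)
  qed
  then show False using freq by (simp add: frequently_def)
qed

text \<open>About each point of F a small disc eventually has mass at least
  \<open>\<epsilon>0\<close>. Since F is finite, one index n serves all its points, and the masses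
  of disjoint discs add up to at most C.\<close>

lemma card_Sigma1:
  assumes F: "finite F" "F \<subseteq> Sigma1 u r"
  shows "real (card F) * \<epsilon>0 \<le> C"
proof -
  have Fr: "x \<in> F \<Longrightarrow> cmod x < r" for x using F(2) by (auto simp: Sigma1_def)
  \<comment> \<open>Pairwise distances and distances to the boundary circle; a third of the minimum
    is a radius for disjoint discs inside the ball. The element 1 keeps the set nonempty.\<close>
  define D where "D = insert 1 ((\<lambda>(x,y). dist x y) ` {(x,y) \<in> F \<times> F. x \<noteq> y} \<union> (\<lambda>x. r - cmod x) ` F)"
  have "finite {(x,y) \<in> F \<times> F. x \<noteq> y}" using F(1) by (auto intro: finite_subset[of _ "F \<times> F"])
  then have D: "finite D" "D \<noteq> {}" "\<And>e. e \<in> D \<Longrightarrow> e > 0" using F(1) Fr by (auto simp: D_def)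
  define d where "d = Min D / 3"
  have d: "d > 0" "\<And>e. e \<in> D \<Longrightarrow> 3 * d \<le> e" using D by (auto simp: d_def)
  have sub: "cball x d \<subseteq> ball 0 r" if "x \<in> F" for x
  proof
    fix y assume "y \<in> cball x d"
    moreover have "3 * d \<le> r - cmod x" using that by (intro d(2)) (auto simp: D_def)
    ultimately show "y \<in> ball 0 r" using dist_triangle[of 0 y x] d(1) by simp
  qed
  have disj: "ball x d \<inter> ball y d = {}" if "x \<in> F" "y \<in> F" "x \<noteq> y" for x y
  proof -
    have "3 * d \<le> dist x y" using that by (intro d(2)) (auto simp: D_def)
    then show ?thesis using d(1) by (intro disjoint_ballI) simp
  qed
  define g where "g = (\<lambda>n x. cmod x powr (2 * \<alpha>s n) * exp (2 * u n x))"
  have ev: "eventually (\<lambda>n. ennreal \<epsilon>0 \<le> (\<integral>\<^sup>+z\<in>ball x d. ennreal (g n z) \<partial>lborel)) sequentially" if "x \<in> F" for x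
    using frequently_small_mass_not_Sigma1[OF d(1) sub[OF that]] F(2) that
    by (auto simp: frequently_def not_less g_def)
  have "eventually (\<lambda>n. \<forall>x\<in>F. ennreal \<epsilon>0 \<le> (\<integral>\<^sup>+z\<in>ball x d. ennreal (g n z) \<partial>lborel)) sequentially"
    using F(1) ev by (intro eventually_ball_finite) auto
  then obtain n where n: "\<And>x. x \<in> F \<Longrightarrow> ennreal \<epsilon>0 \<le> (\<integral>\<^sup>+z\<in>ball x d. ennreal (g n z) \<partial>lborel)"
    using eventually_happens'[OF sequentially_bot] by blast
  have meas: "(\<lambda>z. ennreal (g n z) * indicator (ball x d) z) \<in> borel_measurable lborel" if "x \<in> F" for x
  proof -
    have "continuous_on (ball x d) (g n)" unfolding g_def
      using alpha(1) sub[OF that] by (intro continuous_intros continuous_on_powr' continuous_on_subset[OF continuous_u]) auto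
    then have "(\<lambda>z. indicator (ball x d) z *\<^sub>R g n z) \<in> borel_measurable borel"
      by (intro borel_measurable_continuous_on_indicator) auto
    then have "(\<lambda>z. ennreal (indicator (ball x d) z *\<^sub>R g n z)) \<in> borel_measurable borel" by measurable
    also have "(\<lambda>z. ennreal (indicator (ball x d) z *\<^sub>R g n z)) = (\<lambda>z. ennreal (g n z) * indicator (ball x d) z)"
      by (auto simp: indicator_def)
    finally show ?thesis by simp
  qed
  have "ennreal (real (card F) * \<epsilon>0) = (\<Sum>x\<in>F. ennreal \<epsilon>0)"
    using \<epsilon>0 by (simp add: ennreal_mult ennreal_of_nat_eq_real_of_nat)
  also have "\<dots> \<le> (\<Sum>x\<in>F. \<integral>\<^sup>+z\<in>ball x d. ennreal (g n z) \<partial>lborel)" by (intro sum_mono n)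
  also have "\<dots> = (\<integral>\<^sup>+z. (\<Sum>x\<in>F. ennreal (g n z) * indicator (ball x d) z) \<partial>lborel)"
    by (rule nn_integral_sum[symmetric]) (rule meas)
  also have "\<dots> \<le> (\<integral>\<^sup>+z\<in>ball 0 r. ennreal (g n z) \<partial>lborel)"
  proof (rule nn_integral_mono)
    fix z
    show "(\<Sum>x\<in>F. ennreal (g n z) * indicator (ball x d) z) \<le> ennreal (g n z) * indicator (ball 0 r) z"
    proof (cases "\<exists>x\<in>F. z \<in> ball x d")
      case True
      then obtain x where x: "x \<in> F" "z \<in> ball x d" by blast
      then have "z \<notin> ball y d" if "y \<in> F - {x}" for y using disj[of x y] that by blast
      then have "(\<Sum>y\<in>F. ennreal (g n z) * indicator (ball y d) z) = ennreal (g n z)"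
        using F(1) x by (subst sum.remove[of F x]) auto
      moreover have "z \<in> ball 0 r" using sub[OF x(1)] x(2) by (auto simp: subset_iff)
      ultimately show ?thesis by simp
    qed auto
  qed
  also have "\<dots> \<le> ennreal C" using energy_u[of n] by (simp add: g_def less_imp_le)
  finally show ?thesis using C by (simp add: ennreal_le_iff)
qed

lemma finite_Sigma1: "finite (Sigma1 u r)" "card (Sigma1 u r) \<le> nat \<lceil>C / \<epsilon>0\<rceil>"
proof -
  have "card F \<le> nat \<lceil>C / \<epsilon>0\<rceil>" if "F \<subseteq> Sigma1 u r" "finite F" for F
  proof -
    have "real (card F) \<le> C / \<epsilon>0" using card_Sigma1[OF that(2,1)] \<epsilon>0(1) by (simp add: pos_le_divide_eq)
    then show ?thesis by linarith
  qed
  then have "finite (Sigma1 u r) \<and> card (Sigma1 u r) \<le> nat \<lceil>C / \<epsilon>0\<rceil>"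
    by (rule finite_if_finite_subsets_card_bdd)
  then show "finite (Sigma1 u r)" "card (Sigma1 u r) \<le> nat \<lceil>C / \<epsilon>0\<rceil>" by simp_all
qed

section \<open>Spinor bounds and Harnack inequality for solutions\<close>

lemma weight_bound:
  assumes "x \<in> ball 0 r" shows "cmod x powr \<alpha>s n \<le> max 1 r powr A"
proof -
  have "cmod x powr \<alpha>s n \<le> max 1 r powr \<alpha>s n" using assms alpha(1)[of n] by (intro powr_mono2) auto
  also have "\<dots> \<le> max 1 r powr A" using alpha by (intro powr_mono) auto
  finally show ?thesis .
qed

lemma coupling_bound:
  assumes x: "x \<in> ball 0 r" and u: "u n x \<le> M"
  shows "0 \<le> V x * cmod x powr \<alpha>s n * exp (u n x)" "V x * cmod x powr \<alpha>s n * exp (u n x) \<le> b * max 1 r powr A * exp M"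
proof -
  have V: "0 \<le> V x" "V x \<le> b" using V_bounds x by force+
  then show "0 \<le> V x * cmod x powr \<alpha>s n * exp (u n x)" by simp
  show "V x * cmod x powr \<alpha>s n * exp (u n x) \<le> b * max 1 r powr A * exp M"
    using V u weight_bound[OF x, of n] b_pos by (intro mult_mono) auto
qed

text \<open>Where u is at most M the coefficient of the Dirac equation is at most \<open>M'\<close>,
  so \<open>dirac_bound\<close> applies. The hypothesis concerns one n and s, B precede n, which
  permits use along infinitely many indices.\<close>

lemma spinor_bounded:
  assumes d: "d > 0" "ball x1 d \<subseteq> ball 0 r"
  obtains s B where "s > 0" "\<And>n y. \<forall>z\<in>ball x1 d. u n z \<le> M \<Longrightarrow> y \<in> ball x1 s \<Longrightarrow> norm (\<Psi> n y) \<le> B"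
proof -
  define \<delta> where "\<delta> = d / 2"
  define M' where "M' = b * max 1 r powr A * exp M"
  define B where "B = 16 * \<delta>\<^sup>2 + 16 * C / pi * (4 + 256 * M'\<^sup>2 * \<delta>\<^sup>2)"
  have \<delta>: "\<delta> > 0" using d by (simp add: \<delta>_def)
  have M': "M' > 0" using b_pos by (auto simp: M'_def)
  show ?thesis
  proof (rule that)
    show "\<delta> / 2 > 0" using \<delta> by simp
    fix n y assume "\<forall>z\<in>ball x1 d. u n z \<le> M" and y: "y \<in> ball x1 (\<delta> / 2)"
    then have uM: "\<And>z. z \<in> ball x1 d \<Longrightarrow> u n z \<le> M" by blast
    have sub: "ball x1 \<delta> \<subseteq> ball x1 d" "cball x1 \<delta> \<subseteq> ball x1 d" using d by (auto simp: \<delta>_def)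
    note P = C1_on_has_partials[OF reg_\<Psi>[of n]]
    note f = has_partials_linear[OF P bounded_linear_fst]
    note g = has_partials_linear[OF P bounded_linear_snd]
    have dirac: "cmod (fst (px (\<Psi> n) x) - \<i> * fst (py (\<Psi> n) x)) \<le> M' * norm (\<Psi> n x)"
      "cmod (snd (px (\<Psi> n) x) + \<i> * snd (py (\<Psi> n) x)) \<le> M' * norm (\<Psi> n x)" if x: "x \<in> ball x1 \<delta>" for x
    proof -
      have xr: "x \<in> ball 0 r" using x sub d by blast
      have "norm (dirac (\<Psi> n) x) = V x * cmod x powr (\<alpha>s n) * exp (u n x) * norm (\<Psi> n x)"
      proof -
        have "0 \<le> V x * cmod x powr (\<alpha>s n) * exp (u n x)"
          by (rule coupling_bound(1)[OF xr uM]) (use x sub in auto)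
        then show ?thesis unfolding eq_\<Psi>[OF xr] norm_scaleR abs_minus_cancel by (simp only: abs_of_nonneg)
      qed
      also have "\<dots> \<le> M' * norm (\<Psi> n x)" unfolding M'_def
        using coupling_bound(2)[OF xr uM] x sub by (intro mult_right_mono) auto
      finally have *: "norm (dirac (\<Psi> n) x) \<le> M' * norm (\<Psi> n x)" .
      have "dirac (\<Psi> n) x = (snd (px (\<Psi> n) x) + \<i> * snd (py (\<Psi> n) x), - (fst (px (\<Psi> n) x) - \<i> * fst (py (\<Psi> n) x)))"
        unfolding dirac_def using has_partials_eq[OF f xr] has_partials_eq[OF g xr] by simp
      then have "cmod (fst (px (\<Psi> n) x) - \<i> * fst (py (\<Psi> n) x)) \<le> norm (dirac (\<Psi> n) x)"
         "cmod (snd (px (\<Psi> n) x) + \<i> * snd (py (\<Psi> n) x)) \<le> norm (dirac (\<Psi> n) x)"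
        using norm_fst_le norm_snd_le by (metis norm_minus_cancel, metis)
      then show "cmod (fst (px (\<Psi> n) x) - \<i> * fst (py (\<Psi> n) x)) \<le> M' * norm (\<Psi> n x)"
        "cmod (snd (px (\<Psi> n) x) + \<i> * snd (py (\<Psi> n) x)) \<le> M' * norm (\<Psi> n x)" using * by linarith+
    qed
    have energy: "(\<integral>\<^sup>+x\<in>ball x1 \<delta>. ennreal (norm (fst (\<Psi> n x), snd (\<Psi> n x)) ^ 4) \<partial>lborel) \<le> ennreal C"
    proof -
      have "(\<integral>\<^sup>+x\<in>ball x1 \<delta>. ennreal (norm (fst (\<Psi> n x), snd (\<Psi> n x)) ^ 4) \<partial>lborel) \<le> (\<integral>\<^sup>+x\<in>ball 0 r. ennreal (norm (\<Psi> n x) ^ 4) \<partial>lborel)"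
      proof (rule nn_integral_mono)
        fix x
        have "x \<in> ball x1 \<delta> \<Longrightarrow> x \<in> ball 0 r" using sub(1) d(2) by blast
        then show "ennreal (norm (fst (\<Psi> n x), snd (\<Psi> n x)) ^ 4) * indicator (ball x1 \<delta>) x
            \<le> ennreal (norm (\<Psi> n x) ^ 4) * indicator (ball 0 r) x"
          by (auto simp: indicator_def)
      qed
      also have "\<dots> \<le> ennreal C" using energy_\<Psi>[of n] by (rule less_imp_le)
      finally show ?thesis .
    qed
    have "(\<delta> - dist x1 y)\<^sup>2 * norm (fst (\<Psi> n y), snd (\<Psi> n y)) \<le> B" unfolding B_def
      by (rule dirac_bound[OF f g _ \<delta> M' _ _ _ energy]) (use sub d(2) C dirac y \<delta> in auto)
    then have "(\<delta> - dist x1 y)\<^sup>2 * norm (\<Psi> n y) \<le> B" by simp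
    moreover have "(\<delta> / 2)\<^sup>2 * norm (\<Psi> n y) \<le> (\<delta> - dist x1 y)\<^sup>2 * norm (\<Psi> n y)"
      using y \<delta> by (intro mult_right_mono power_mono) auto
    ultimately have "(\<delta> / 2)\<^sup>2 * norm (\<Psi> n y) \<le> B" by linarith
    then show "norm (\<Psi> n y) \<le> B / (\<delta> / 2)\<^sup>2" using \<delta> by (subst pos_le_divide_eq) (simp_all add: mult.commute)
  qed
qed

text \<open>\<open>harnack_ball\<close> is applied to the nonnegative function
  \<open>M - u n\<close>, whose Laplacian is bounded because both nonlinear terms are. The resulting
  inequality spreads lower bounds for u as well as divergence to minus infinity.\<close>

lemma harnack:
  assumes d: "d > 0" "ball x1 d \<subseteq> ball 0 r"
  obtains s c where "s > 0" "s \<le> d" "\<And>n y z. \<forall>x\<in>ball x1 d. u n x \<le> M \<and> norm (\<Psi> n x) \<le> B \<Longrightarrow>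
     y \<in> ball x1 s \<Longrightarrow> z \<in> ball x1 s \<Longrightarrow> 9 * u n z \<le> u n y + c"
proof -
  define Q where "Q = b * max 1 r powr A * exp M"
  define K where "K = 2 * Q\<^sup>2 + Q * B\<^sup>2"
  define s where "s = d / 4"
  have s: "s > 0" "4 * s = d" "s \<le> d" using d by (auto simp: s_def)
  show ?thesis
  proof (rule that[OF s(1,3)])
    fix n y z assume "\<forall>x\<in>ball x1 d. u n x \<le> M \<and> norm (\<Psi> n x) \<le> B" and yz: "y \<in> ball x1 s" "z \<in> ball x1 s"
    then have bd: "\<And>x. x \<in> ball x1 d \<Longrightarrow> u n x \<le> M \<and> norm (\<Psi> n x) \<le> B" by blast
    have "M + -1 * u n y \<le> 9 * (M + -1 * u n z) + 21 * K * s\<^sup>2"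
    proof (rule harnack_ball[OF has_laplacian_add[OF has_laplacian_const has_laplacian_cmult[OF has_laplacian_u]] _ s(1) _ _ yz])
      fix x assume "x \<in> ball x1 (4 * s)"
      then have x: "x \<in> ball x1 d" unfolding s(2) .
      then have xr: "x \<in> ball 0 r" using d by blast
      note bdx = bd[OF x]
      show "0 \<le> M + -1 * u n x" using bdx by simp
      \<comment> \<open>In terms of q the equation reads: the Laplacian of u is
        \<open>q * (norm (\<Psi> n x))\<^sup>2 - 2 * q\<^sup>2\<close>.\<close>
      define q where "q = V x * cmod x powr \<alpha>s n * exp (u n x)"
      have q: "0 \<le> q" "q \<le> Q" unfolding q_def Q_def using coupling_bound[OF xr] bdx by auto
      have "(V x)\<^sup>2 * cmod x powr (2 * \<alpha>s n) * exp (2 * u n x) = q\<^sup>2"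
      proof -
        have "cmod x powr (2 * \<alpha>s n) = (cmod x powr \<alpha>s n)\<^sup>2" by (simp add: power2_eq_square flip: powr_add)
        then show ?thesis unfolding q_def by (simp add: power_mult_distrib exp_double)
      qed
      then have "laplacian (u n) x = q * (norm (\<Psi> n x))\<^sup>2 - 2 * q\<^sup>2"
        using eq_u[OF xr, of n] unfolding q_def[symmetric] by (simp add: mult.assoc)
      moreover have "q * (norm (\<Psi> n x))\<^sup>2 \<le> Q * B\<^sup>2" using q bdx by (intro mult_mono power_mono) auto
      moreover have "q\<^sup>2 \<le> Q\<^sup>2" using q by (intro power_mono) auto
      moreover have "0 \<le> q * (norm (\<Psi> n x))\<^sup>2" "0 \<le> q\<^sup>2" using q by auto
      ultimately have "laplacian (u n) x \<le> K" "- laplacian (u n) x \<le> K" unfolding K_def by linarith+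
      then show "\<bar>0 + -1 * laplacian (u n) x\<bar> \<le> K" by (simp add: abs_le_iff)
    qed (use s d in auto)
    then show "9 * u n z \<le> u n y + (8 * M + 21 * K * s\<^sup>2)" by simp
  qed
qed

text \<open>Off \<open>Sigma1\<close> the functions u are bounded above near x for infinitely many
  n; for these the spinors are bounded near x, so their norms cannot diverge along the whole
  sequence.\<close>

lemma Sigma2_subset_Sigma1: "Sigma2 \<Psi> r \<subseteq> Sigma1 u r"
proof
  fix x assume "x \<in> Sigma2 \<Psi> r"
  then obtain y where x: "x \<in> ball 0 r" and y: "y \<longlonglongrightarrow> x" "filterlim (\<lambda>n. norm (\<Psi> n (y n))) at_top sequentially"
    by (auto simp: Sigma2_def)
  show "x \<in> Sigma1 u r"
  proof (rule ccontr)
    assume "x \<notin> Sigma1 u r"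
    then obtain s M where s: "s > 0" and fr: "frequently (\<lambda>n. \<forall>y\<in>ball x s \<inter> ball 0 r. u n y \<le> M) sequentially"
      by (rule not_Sigma1_frequently_bounded[OF x])
    obtain e where e: "e > 0" "ball x e \<subseteq> ball 0 r" using x open_ball open_contains_ball by blast
    define d where "d = min s e"
    have d: "d > 0" "ball x d \<subseteq> ball 0 r" using s e by (auto simp: d_def)
    obtain t B where t: "t > 0" and tB: "\<And>n y. \<forall>z\<in>ball x d. u n z \<le> M \<Longrightarrow> y \<in> ball x t \<Longrightarrow> norm (\<Psi> n y) \<le> B"
      by (rule spinor_bounded[OF d, of M]) (rule that)
    have "eventually (\<lambda>n. dist (y n) x < t) sequentially" using y(1) t by (rule tendstoD)
    moreover have "eventually (\<lambda>n. norm (\<Psi> n (y n)) > B) sequentially"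
      using y(2) by (simp add: filterlim_at_top_dense)
    ultimately have "eventually (\<lambda>n. \<not> (\<forall>y\<in>ball x s \<inter> ball 0 r. u n y \<le> M)) sequentially"
    proof eventually_elim
      case (elim n)
      then have "\<exists>z\<in>ball x d. \<not> u n z \<le> M" using tB[of n "y n"] by (metis dist_commute mem_ball not_le)
      then obtain z where z: "z \<in> ball x d" "\<not> u n z \<le> M" by blast
      moreover have "z \<in> ball x s \<inter> ball 0 r" using z(1) d(2) by (auto simp: d_def)
      ultimately show ?case by blast
    qed
    then show False using fr by (simp add: frequently_def)
  qed
qed

end

section \<open>Propagation along connected open sets\<close>

context
  fixes \<Omega> :: "complex set" and w :: "nat \<Rightarrow> complex \<Rightarrow> real" and x0 :: complex
  assumes \<Omega>: "open \<Omega>" "connected \<Omega>" "x0 \<in> \<Omega>"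
    and harnack: "\<And>x. x \<in> \<Omega> \<Longrightarrow> \<exists>s>0. \<exists>c. eventually (\<lambda>n. \<forall>y\<in>ball x s. \<forall>z\<in>ball x s. 9 * w n z \<le> w n y + c) sequentially"
begin

text \<open>A lower bound L at one point of a Harnack ball becomes \<open>9 * L - c\<close> at every
  other, so connectedness carries a bound from \<open>x0\<close> to each point. The bounds depend on
  the point; a covering makes them uniform on compact sets.\<close>

lemma harnack_bounded:
  assumes cont: "\<And>n. continuous_on \<Omega> (w n)" and above: "\<And>x. x \<in> \<Omega> \<Longrightarrow> locally_bdd_above w x"
    and x0: "eventually (\<lambda>n. w n x0 \<ge> L) sequentially"
  shows "bounded_loc \<Omega> w"
proof -
  have all: "\<exists>L. eventually (\<lambda>n. w n x \<ge> L) sequentially" if "x \<in> \<Omega>" for x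
  proof (rule connected_induction_simple[OF \<Omega>(2,3) that])
    show "\<exists>L. eventually (\<lambda>n. w n x0 \<ge> L) sequentially" using x0 by blast
    fix p assume p: "p \<in> \<Omega>"
    obtain s c where s: "s > 0" and ev: "eventually (\<lambda>n. \<forall>y\<in>ball p s. \<forall>z\<in>ball p s. 9 * w n z \<le> w n y + c) sequentially"
      using harnack[OF p] by blast
    show "\<exists>T. openin (top_of_set \<Omega>) T \<and> p \<in> T \<and> (\<forall>x\<in>T. \<forall>y\<in>T.
      (\<exists>L. eventually (\<lambda>n. w n x \<ge> L) sequentially) \<longrightarrow> (\<exists>L. eventually (\<lambda>n. w n y \<ge> L) sequentially))"
    proof (intro exI[of _ "\<Omega> \<inter> ball p s"] conjI ballI impI)
      show "openin (top_of_set \<Omega>) (\<Omega> \<inter> ball p s)" by (simp add: openin_open_Int)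
      fix x y assume xy: "x \<in> \<Omega> \<inter> ball p s" "y \<in> \<Omega> \<inter> ball p s" and "\<exists>L. eventually (\<lambda>n. w n x \<ge> L) sequentially"
      then obtain L where "eventually (\<lambda>n. w n x \<ge> L) sequentially" by blast
      with ev have "eventually (\<lambda>n. w n y \<ge> 9 * L - c) sequentially"
      proof eventually_elim
        case (elim n)
        then have "9 * w n x \<le> w n y + c" using xy by blast
        then show ?case using elim(2) by linarith
      qed
      then show "\<exists>L. eventually (\<lambda>n. w n y \<ge> L) sequentially" by blast
    qed (use p s in auto)
  qed
  have below: "locally_bdd_above (\<lambda>n x. - w n x) x" if x: "x \<in> \<Omega>" for x
  proof -
    obtain s c where s: "s > 0" and ev: "eventually (\<lambda>n. \<forall>y\<in>ball x s. \<forall>z\<in>ball x s. 9 * w n z \<le> w n y + c) sequentially"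
      using harnack[OF x] by blast
    obtain L where "eventually (\<lambda>n. w n x \<ge> L) sequentially" using all[OF x] by blast
    with ev have "eventually (\<lambda>n. \<forall>y\<in>ball x s. - w n y \<le> c - 9 * L) sequentially"
    proof eventually_elim
      case (elim n)
      show ?case
      proof
        fix y assume "y \<in> ball x s"
        then have "9 * w n x \<le> w n y + c" using elim(1) s by (meson centre_in_ball)
        then show "- w n y \<le> c - 9 * L" using elim(2) by linarith
      qed
    qed
    then show ?thesis unfolding locally_bdd_above_def using s by blast
  qed
  show ?thesis unfolding bounded_loc_def
  proof (intro allI impI)
    fix K assume K: "compact K \<and> K \<subseteq> \<Omega>"
    obtain M1 where M1: "\<And>n x. x \<in> K \<Longrightarrow> w n x \<le> M1"
      using locally_bdd_above_compact[of K \<Omega> w] K cont above by blast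
    obtain M2 where M2: "\<And>n x. x \<in> K \<Longrightarrow> - w n x \<le> M2"
      using locally_bdd_above_compact[of K \<Omega> "\<lambda>n x. - w n x"] K continuous_on_minus[OF cont] below by blast
    have "norm (w n x) \<le> max M1 M2" if "x \<in> K" for n x
      using M1[OF that, of n] M2[OF that, of n] unfolding real_norm_def by linarith
    then show "\<exists>M. \<forall>n. \<forall>x\<in>K. norm (w n x) \<le> M" by blast
  qed
qed

text \<open>The same inequality read from y to z: one very negative value forces the whole Harnack
  ball down, and connectedness reaches all points.\<close>

lemma harnack_minus_infty:
  assumes x0: "filterlim (\<lambda>n. w n x0) at_bot sequentially"
  shows "to_minus_infty_loc \<Omega> w"
proof -
  have spread: "eventually (\<lambda>n. \<forall>y\<in>ball p s. w n y \<le> - M) sequentially"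
    if ev: "eventually (\<lambda>n. \<forall>y\<in>ball p s. \<forall>z\<in>ball p s. 9 * w n z \<le> w n y + c) sequentially"
      and x: "x \<in> ball p s" "filterlim (\<lambda>n. w n x) at_bot sequentially" for p s c x M
  proof -
    have "eventually (\<lambda>n. w n x \<le> - 9 * M - c) sequentially" using x(2) by (simp add: filterlim_at_bot)
    with ev show ?thesis
    proof eventually_elim
      case (elim n)
      show ?case
      proof
        fix y assume "y \<in> ball p s"
        then have "9 * w n y \<le> w n x + c" using elim(1) x(1) by blast
        then show "w n y \<le> - M" using elim(2) by linarith
      qed
    qed
  qed
  have all: "filterlim (\<lambda>n. w n x) at_bot sequentially" if "x \<in> \<Omega>" for x
  proof (rule connected_induction_simple[OF \<Omega>(2,3) that, of "\<lambda>x. filterlim (\<lambda>n. w n x) at_bot sequentially"])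
    fix p assume p: "p \<in> \<Omega>"
    obtain s c where s: "s > 0" and ev: "eventually (\<lambda>n. \<forall>y\<in>ball p s. \<forall>z\<in>ball p s. 9 * w n z \<le> w n y + c) sequentially"
      using harnack[OF p] by blast
    show "\<exists>T. openin (top_of_set \<Omega>) T \<and> p \<in> T \<and> (\<forall>x\<in>T. \<forall>y\<in>T.
      filterlim (\<lambda>n. w n x) at_bot sequentially \<longrightarrow> filterlim (\<lambda>n. w n y) at_bot sequentially)"
    proof (intro exI[of _ "\<Omega> \<inter> ball p s"] conjI ballI impI)
      show "openin (top_of_set \<Omega>) (\<Omega> \<inter> ball p s)" by (simp add: openin_open_Int)
      fix x y assume xy: "x \<in> \<Omega> \<inter> ball p s" "y \<in> \<Omega> \<inter> ball p s" and x: "filterlim (\<lambda>n. w n x) at_bot sequentially"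
      show "filterlim (\<lambda>n. w n y) at_bot sequentially"
        unfolding filterlim_at_bot
      proof
        fix Z
        have "eventually (\<lambda>n. \<forall>y\<in>ball p s. w n y \<le> - (- Z)) sequentially" by (rule spread[OF ev _ x]) (use xy in blast)
        then show "eventually (\<lambda>n. w n y \<le> Z) sequentially" by (rule eventually_mono) (use xy in auto)
      qed
    qed (use p s in auto)
  qed (rule x0)
  show ?thesis unfolding to_minus_infty_loc_def
  proof (intro allI impI)
    fix K M assume K: "compact K \<and> K \<subseteq> \<Omega>"
    \<comment> \<open>The threshold M is fixed beforehand, and the parameter over which the covering
      lemma maximises is a dummy.\<close>
    have "\<exists>M'::real. eventually (\<lambda>n. \<forall>y\<in>K. w n y \<le> - M) sequentially"
    proof (rule compact_eventually_uniform[where Q="\<lambda>_ n y. w n y \<le> - M"])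
      fix x assume "x \<in> K"
      then have x: "x \<in> \<Omega>" using K by blast
      obtain s c where s: "s > 0" and ev: "eventually (\<lambda>n. \<forall>y\<in>ball x s. \<forall>z\<in>ball x s. 9 * w n z \<le> w n y + c) sequentially"
        using harnack[OF x] by blast
      then show "\<exists>s>0. \<exists>M'::real. eventually (\<lambda>n. \<forall>y\<in>ball x s. w n y \<le> - M) sequentially"
        using spread[OF ev _ all[OF x]] by (meson centre_in_ball)
    qed (use K in auto)
    then show "eventually (\<lambda>n. \<forall>x\<in>K. w n x \<le> - M) sequentially" by blast
  qed
qed

end

lemma (in liouville_dirac) local_harnack:
  assumes x: "x \<in> ball 0 r" and bdd: "locally_bdd_above u x" "locally_bdd_above (\<lambda>n x. norm (\<Psi> n x)) x"
  shows "\<exists>s>0. \<exists>c. eventually (\<lambda>n. \<forall>y\<in>ball x s. \<forall>z\<in>ball x s. 9 * u n z \<le> u n y + c) sequentially"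
proof -
  obtain s1 M where s1: "s1 > 0" and M: "eventually (\<lambda>n. \<forall>y\<in>ball x s1. u n y \<le> M) sequentially"
    using bdd(1) by (auto simp: locally_bdd_above_def)
  obtain s2 B where s2: "s2 > 0" and B: "eventually (\<lambda>n. \<forall>y\<in>ball x s2. norm (\<Psi> n y) \<le> B) sequentially"
    using bdd(2) by (auto simp: locally_bdd_above_def)
  obtain e where e: "e > 0" "ball x e \<subseteq> ball 0 r" using x open_ball open_contains_ball by blast
  define d where "d = min e (min s1 s2)"
  have d: "d > 0" "ball x d \<subseteq> ball 0 r" using s1 s2 e by (auto simp: d_def)
  obtain s c where s: "s > 0" "\<And>n y z. \<forall>x\<in>ball x d. u n x \<le> M \<and> norm (\<Psi> n x) \<le> B \<Longrightarrow>
     y \<in> ball x s \<Longrightarrow> z \<in> ball x s \<Longrightarrow> 9 * u n z \<le> u n y + c"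
    by (rule harnack[OF d, of M B]) (rule that)
  have "eventually (\<lambda>n. \<forall>y\<in>ball x s. \<forall>z\<in>ball x s. 9 * u n z \<le> u n y + c) sequentially"
    using M B
  proof eventually_elim
    case (elim n)
    have "\<forall>x\<in>ball x d. u n x \<le> M \<and> norm (\<Psi> n x) \<le> B" using elim by (simp add: d_def)
    then show ?case using s(2) by blast
  qed
  then show ?thesis using s(1) by blast
qed

text \<open>Removing finitely many points leaves the disc connected, so one point \<open>x0\<close>
  decides: either its values are eventually bounded below, or a subsequence diverges to minus
  infinity there.\<close>

lemma (in liouville_dirac) harnack_alternative:
  assumes S: "finite S" and bdd: "\<And>x. x \<in> ball 0 r - S \<Longrightarrow> locally_bdd_above u x"
    "\<And>x. x \<in> ball 0 r - S \<Longrightarrow> locally_bdd_above (\<lambda>n x. norm (\<Psi> n x)) x"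
  obtains t :: "nat \<Rightarrow> nat" where "strict_mono t"
    "bounded_loc (ball 0 r - S) (\<lambda>n. u (t n)) \<or> to_minus_infty_loc (ball 0 r - S) (\<lambda>n. u (t n))"
proof -
  define \<Omega> where "\<Omega> = ball 0 r - S"
  have "infinite (ball (0::complex) r)" using uncountable_ball[OF r] countable_finite by blast
  then obtain x0 where x0: "x0 \<in> \<Omega>" unfolding \<Omega>_def using S using Diff_infinite_finite[of S "ball 0 r"] by (metis finite.emptyI ex_in_conv)
  have op: "open \<Omega>" unfolding \<Omega>_def using S by (intro open_Diff open_ball finite_imp_closed)
  have con: "connected \<Omega>" unfolding \<Omega>_def using S by (intro connected_open_delete_finite) auto
  have har: "\<And>x. x \<in> \<Omega> \<Longrightarrow> \<exists>s>0. \<exists>c. eventually (\<lambda>n. \<forall>y\<in>ball x s. \<forall>z\<in>ball x s. 9 * u n z \<le> u n y + c) sequentially"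
    using local_harnack bdd by (auto simp: \<Omega>_def)
  show ?thesis
  proof (cases "\<exists>L. eventually (\<lambda>n. u n x0 \<ge> L) sequentially")
    case True
    then obtain L where "eventually (\<lambda>n. u n x0 \<ge> L) sequentially" by blast
    then have "bounded_loc \<Omega> u"
      by (intro harnack_bounded[OF op con x0 har]) (use bdd in \<open>auto simp: \<Omega>_def intro: continuous_on_subset[OF continuous_u]\<close>)
    then show ?thesis using that[of id] by (simp add: \<Omega>_def strict_mono_id)
  next
    case False
    have "frequently (\<lambda>n. u n x0 < - real k) sequentially" for k
      using False by (auto simp: frequently_def not_less)
    then obtain t where t: "strict_mono t" "\<And>k. u (t k) x0 < - real k"
      using diagonal_subsequence[of "\<lambda>k n. u n x0 < - real k"] by blast
    interpret sub: liouville_dirac "\<lambda>n. u (t n)" "\<lambda>n. \<Psi> (t n)" V "\<lambda>n. \<alpha>s (t n)" A r C a b by (rule subsequence)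
    have "to_minus_infty_loc \<Omega> (\<lambda>n. u (t n))"
    proof (rule harnack_minus_infty[OF op con x0])
      have lim: "filterlim (\<lambda>k. - real k) at_bot sequentially"
        by (simp add: filterlim_uminus_at_bot filterlim_real_sequentially)
      show "filterlim (\<lambda>n. u (t n) x0) at_bot sequentially"
        by (rule filterlim_at_bot_mono[OF lim]) (use t(2) in \<open>auto intro: always_eventually less_imp_le\<close>)
      fix x assume "x \<in> \<Omega>"
      then show "\<exists>s>0. \<exists>c. eventually (\<lambda>n. \<forall>y\<in>ball x s. \<forall>z\<in>ball x s. 9 * u (t n) z \<le> u (t n) y + c) sequentially"
        using har eventually_subseq[OF t(1)] by meson
    qed
    then show ?thesis using that[OF t(1)] by (simp add: \<Omega>_def)
  qed
qed

section \<open>Stabilised blow-up sets and the alternatives\<close>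

lemma Sigma2_eq_Sigma1: "Sigma2 \<Psi> r = Sigma1 (\<lambda>n x. norm (\<Psi> n x)) r"
  by (simp add: Sigma1_def Sigma2_def)

theorem theorem1p1:
  fixes u :: "nat \<Rightarrow> complex \<Rightarrow> real"
    and \<Psi> :: "nat \<Rightarrow> complex \<Rightarrow> complex \<times> complex"
    and V :: "complex \<Rightarrow> real"
    and \<alpha>s :: "nat \<Rightarrow> real" and \<alpha> r C a b \<beta> :: real
  assumes r: "r > 0"
    and reg_u: "\<And>n. C2_on (ball 0 r) (u n)"
    and reg_\<Psi>: "\<And>n. C1_on (ball 0 r) (\<Psi> n)"
    and eq_u: "\<And>n x. x \<in> ball 0 r \<Longrightarrow>
        - laplacian (u n) x = 2 * (V x)\<^sup>2 * cmod x powr (2 * \<alpha>s n) * exp (2 * u n x)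
                               - V x * cmod x powr (\<alpha>s n) * exp (u n x) * (norm (\<Psi> n x))\<^sup>2"
    and eq_\<Psi>: "\<And>n x. x \<in> ball 0 r \<Longrightarrow>
        dirac (\<Psi> n) x = (- (V x * cmod x powr (\<alpha>s n) * exp (u n x))) *\<^sub>R \<Psi> n x"
    and C: "C > 0"
    and energy_u: "\<And>n. set_nn_integral lborel (ball 0 r)
                      (\<lambda>x. ennreal (cmod x powr (2 * \<alpha>s n) * exp (2 * u n x))) < ennreal C"
    and energy_\<Psi>: "\<And>n. set_nn_integral lborel (ball 0 r)
                      (\<lambda>x. ennreal ((norm (\<Psi> n x)) ^ 4)) < ennreal C"
    and alpha_pos: "\<And>n. \<alpha>s n > 0"
    and alpha_lim: "\<alpha>s \<longlonglongrightarrow> \<alpha>" and alpha_nonneg: "\<alpha> \<ge> 0"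
    and beta: "0 < \<beta>" "\<beta> < 1"
    and V_reg: "C1_holder_on (ball 0 r) \<beta> V"
    and V_bounds: "0 < a" "\<And>x. x \<in> ball 0 r \<Longrightarrow> a \<le> V x \<and> V x \<le> b"
  shows "Sigma2 \<Psi> r \<subseteq> Sigma1 u r \<and>
    (\<exists>s::nat \<Rightarrow> nat. strict_mono s \<and>
       (let u' = (\<lambda>n. u (s n)); \<Psi>' = (\<lambda>n. \<Psi> (s n));
            S1 = Sigma1 u' r; S2 = Sigma2 \<Psi>' r in
        bounded_loc (ball 0 r - S2) \<Psi>' \<and>
        (bounded_loc (ball 0 r) u'
         \<or> to_minus_infty_loc (ball 0 r) u'
         \<or> (finite S1 \<and> S1 \<noteq> {} \<and>
            (bounded_loc (ball 0 r - S1) u' \<or> to_minus_infty_loc (ball 0 r - S1) u')))))"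
proof -
  obtain A where A: "\<And>n. \<alpha>s n \<le> A"
    using convergent_imp_Bseq[OF convergentI[OF alpha_lim]] unfolding Bseq_def by (metis abs_le_D1 real_norm_def)
  interpret liouville_dirac u \<Psi> V \<alpha>s A r C a b
    by unfold_locales (use r reg_u reg_\<Psi> eq_u eq_\<Psi> C energy_u energy_\<Psi> alpha_pos A V_bounds in blast)+
  let ?S1 = "\<lambda>t::nat \<Rightarrow> nat. Sigma1 (\<lambda>n. u (t n)) r"
  let ?S2 = "\<lambda>t::nat \<Rightarrow> nat. Sigma2 (\<lambda>n. \<Psi> (t n)) r"
  have fin: "finite (?S1 t)" "finite (?S2 t)" "?S2 t \<subseteq> ?S1 t" "card (?S1 t) + card (?S2 t) \<le> 2 * nat \<lceil>C / \<epsilon>0\<rceil>" for t :: "nat \<Rightarrow> nat"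
  proof -
    interpret sub: liouville_dirac "\<lambda>n. u (t n)" "\<lambda>n. \<Psi> (t n)" V "\<lambda>n. \<alpha>s (t n)" A r C a b by (rule subsequence)
    show f1: "finite (?S1 t)" and f3: "?S2 t \<subseteq> ?S1 t"
      by (rule sub.finite_Sigma1, rule sub.Sigma2_subset_Sigma1)
    then show "finite (?S2 t)" by (rule finite_subset[rotated])
    show "card (?S1 t) + card (?S2 t) \<le> 2 * nat \<lceil>C / \<epsilon>0\<rceil>"
      using sub.finite_Sigma1(2) card_mono[OF f1 f3] by linarith
  qed
  text \<open>Blow-up sets grow along subsequences, so one that maximises their size has blow-up sets that are
    stable under further extraction, and there is local boundedness off them.\<close>
  define N where "N = (\<lambda>t. card (?S1 t) + card (?S2 t))"
  have "\<exists>s. strict_mono s \<and> (\<forall>t. strict_mono t \<longrightarrow> N t \<le> N s)"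
    by (rule ex_has_greatest_nat[of strict_mono id N "Suc (2 * nat \<lceil>C / \<epsilon>0\<rceil>)"])
       (use fin(4) in \<open>auto simp: N_def strict_mono_id less_Suc_eq_le intro: le_SucI\<close>)
  then obtain s where s: "strict_mono s" and max: "\<And>t. strict_mono t \<Longrightarrow> N t \<le> N s" by blast
  have stable: "?S1 (\<lambda>n. s (t n)) = ?S1 s" "?S2 (\<lambda>n. s (t n)) = ?S2 s" if t: "strict_mono t" for t
  proof -
    have st: "strict_mono (\<lambda>n. s (t n))" using strict_mono_o[OF s t] by (simp add: o_def)
    have i: "?S1 s \<subseteq> ?S1 (\<lambda>n. s (t n))" "?S2 s \<subseteq> ?S2 (\<lambda>n. s (t n))"
      using Sigma1_subsequence[OF t, of "\<lambda>n. u (s n)" r] Sigma1_subsequence[OF t, of "\<lambda>n x. norm (\<Psi> (s n) x)" r]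
      unfolding Sigma2_eq_Sigma1 by auto
    \<comment> \<open>Both cardinalities can only grow while their sum is maximal, so neither
      changes; an inclusion of finite sets of equal size is an equality.\<close>
    have c: "card (?S1 s) \<le> card (?S1 (\<lambda>n. s (t n)))" "card (?S2 s) \<le> card (?S2 (\<lambda>n. s (t n)))"
      by (rule card_mono[OF fin(1) i(1)], rule card_mono[OF fin(2) i(2)])
    then have ce: "card (?S1 s) = card (?S1 (\<lambda>n. s (t n)))" "card (?S2 s) = card (?S2 (\<lambda>n. s (t n)))"
      using max[OF st] unfolding N_def by linarith+
    show "?S1 (\<lambda>n. s (t n)) = ?S1 s" "?S2 (\<lambda>n. s (t n)) = ?S2 s"
      using card_subset_eq[OF fin(1) i(1) ce(1)] card_subset_eq[OF fin(2) i(2) ce(2)] by simp_all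
  qed
  \<comment> \<open>Otherwise a further extraction would add x to the blow-up set, against
    stability.\<close>
  have bdd1: "locally_bdd_above (\<lambda>n. u (s n)) x" if "x \<in> ball 0 r - ?S1 s" for x
    using Sigma1_new_point[of x r "\<lambda>n. u (s n)"] stable(1) that by blast
  have bdd2: "locally_bdd_above (\<lambda>n x. norm (\<Psi> (s n) x)) x" if "x \<in> ball 0 r - ?S2 s" for x
    using Sigma1_new_point[of x r "\<lambda>n x. norm (\<Psi> (s n) x)"] stable(2)[unfolded Sigma2_eq_Sigma1] that[unfolded Sigma2_eq_Sigma1] by blast
  interpret sub: liouville_dirac "\<lambda>n. u (s n)" "\<lambda>n. \<Psi> (s n)" V "\<lambda>n. \<alpha>s (s n)" A r C a b by (rule subsequence)
  obtain t where t: "strict_mono t"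
    and alt: "bounded_loc (ball 0 r - ?S1 s) (\<lambda>n. u (s (t n))) \<or> to_minus_infty_loc (ball 0 r - ?S1 s) (\<lambda>n. u (s (t n)))"
    by (rule sub.harnack_alternative[of "?S1 s"]) (use fin bdd1 bdd2 in blast)+
  have \<Psi>: "bounded_loc (ball 0 r - ?S2 s) (\<lambda>n. \<Psi> (s (t n)))"
    unfolding bounded_loc_def
  proof (intro allI impI)
    fix K assume K: "compact K \<and> K \<subseteq> ball 0 r - ?S2 s"
    have "\<exists>M. \<forall>n. \<forall>x\<in>K. norm (\<Psi> (s n) x) \<le> M"
      by (rule locally_bdd_above_compact[of K "ball 0 r"])
         (use K bdd2 in \<open>auto intro!: continuous_on_norm continuous_\<Psi>\<close>)
    then show "\<exists>M. \<forall>n. \<forall>x\<in>K. norm (\<Psi> (s (t n)) x) \<le> M" by blast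
  qed
  have "strict_mono (\<lambda>n. s (t n))" using strict_mono_o[OF s t] by (simp add: o_def)
  moreover have "finite (?S1 s)" by (rule fin)
  \<comment> \<open>By stability the blow-up sets of the last extraction are those of s. If
    \<open>?S1 s\<close> is empty, its complement is the whole ball and \<open>alt\<close> gives the
    first or second alternative; otherwise it gives the third.\<close>
  ultimately show ?thesis
    using Sigma2_subset_Sigma1 \<Psi> alt
    by (cases "?S1 s = {}") (auto simp: Let_def stable[OF t] intro!: exI[of _ "\<lambda>n. s (t n)"])
qed

end
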